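(* Set $m=1$. For every $\lambda\in(0,1)$ there exists a constant $C>0$ such that for all $n\in\mathbb{N}$, $n\ge 1$, and all sets of constraints $(\eta,\Delta)$, the mixing time of the Glauber dynamics with parameter $\lambda$ on the set $\Omega(\eta,\Delta)$ of triangulations of $\Lambda^0_{1,n}$ compatible with the constraints satisfies $$T_{\mathrm{mix}}\le C n^2.$$
   Context: Triangulations. $\Lambda^0_{m,n}=\{0,1,\dots,m\}\times\{0,1,\dots,n\}\subset\mathbb{Z}^2$. An edge is a straight segment joining two points of $\Lambda^0_{m,n}$ and passing through no other integer point. Two edges cross if they are distinct and meet at a point that is not a common endpoint. A (full) triangulation of $\Lambda^0_{m,n}$ is a maximal set of pairwise noncrossing edges. In every triangulation the set of midpoints of the edges is exactly $\Lambda=\Lambda_{m,n}=\bigl(\{0,\frac12,1,\dots,m\}\times\{0,\frac12,1,\dots,n\}\bigr)\setminus\Lambda^0_{m,n}$, each midpoint occurring once; so a triangulation is written $\sigma=\{\sigma_x\}_{x\in\Lambda}$, where $\sigma_x$ is the edge with midpoint $x$. Constraints. A set of constraints $(\eta,\Delta)$ is a subset $\Delta\subseteq\Lambda$ together with pairwise noncrossing edges $\eta=\{\eta_x\}_{x\in\Delta}$, $\eta_x$ having midpoint $x$. $\Omega(\eta,\Delta)$ is the (nonempty) set of triangulations $\sigma$ with $\sigma_x=\eta_x$ for all $x\in\Delta$. Gibbs distribution. $|\sigma_x|$ is the $\ell_1$ length of $\sigma_x$, $|\sigma|=\sum_x|\sigma_x|$, and $\mu(\sigma)=\lambda^{|\sigma|}/Z$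 on $\Omega(\eta,\Delta)$ with $Z=\sum_{\sigma\in\Omega(\eta,\Delta)}\lambda^{|\sigma|}$. Glauber dynamics. An edge $\sigma_x$ lying in two triangles of $\sigma$ is flippable if the two triangles form a convex quadrilateral (then necessarily a parallelogram); the flip replaces $\sigma_x$ by the other diagonal $\sigma_x'$ (also with midpoint $x$). One step from $\sigma\in\Omega(\eta,\Delta)$: pick $x$ uniformly at random in $\Lambda\setminus\Delta$ (midpoints of nonconstraint edges); if $\sigma_x$ is flippable to $\sigma'_x$, flip it with probability $\lambda^{|\sigma'_x|}/(\lambda^{|\sigma'_x|}+\lambda^{|\sigma_x|})$; otherwise do nothing. Mixing time. $T_{\mathrm{mix}}=\inf\{t\in\mathbb{N}:\max_{\sigma}\|p^t(\sigma,\cdot)-\mu\|\le 1/4\}$, where $p^t(\sigma,\cdot)$ is the law after $t$ steps started at $\sigma$ and $\|\cdot\|$ is total variation distance. *)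

theory Defs
  imports "HOL-Probability.Probability"
begin

type_synonym point = "real \<times> real"

text \<open>An edge is represented by the two-element set of its endpoints; the straight segment
  itself is the convex hull of that set.\<close>

type_synonym edge = "point set"

definition grid :: "nat \<Rightarrow> nat \<Rightarrow> point set" where
  "grid m n = {(real i, real j) |i j. i \<le> m \<and> j \<le> n}"

definition midpoints :: "nat \<Rightarrow> nat \<Rightarrow> point set" where
  "midpoints m n = {(real i / 2, real j / 2) |i j. i \<le> 2 * m \<and> j \<le> 2 * n} - grid m n"

definition edges :: "nat \<Rightarrow> nat \<Rightarrow> edge set" where
  "edges m n = {{p, q} |p q. p \<in> grid m n \<and> q \<in> grid m n \<and> p \<noteq> q \<and>
                   closed_segment p q \<inter> (\<int> \<times> \<int>) = {p, q}}"

definition edge_midpoint :: "edge \<Rightarrow> point" where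
  "edge_midpoint e = (THE x. \<exists>p q. e = {p, q} \<and> x = midpoint p q)"

definition edge_length :: "edge \<Rightarrow> real" where
  "edge_length e = (THE l. \<exists>p q. e = {p, q} \<and> l = \<bar>fst p - fst q\<bar> + \<bar>snd p - snd q\<bar>)"

definition crosses :: "edge \<Rightarrow> edge \<Rightarrow> bool" where
  "crosses e f \<longleftrightarrow> e \<noteq> f \<and> (\<exists>z. z \<in> convex hull e \<inter> convex hull f \<and> z \<notin> e \<inter> f)"

definition noncrossing :: "edge set \<Rightarrow> bool" where
  "noncrossing S \<longleftrightarrow> (\<forall>e\<in>S. \<forall>f\<in>S. \<not> crosses e f)"

definition triangulation :: "nat \<Rightarrow> nat \<Rightarrow> edge set \<Rightarrow> bool" where
  "triangulation m n \<sigma> \<longleftrightarrow> \<sigma> \<subseteq> edges m n \<and> noncrossing \<sigma> \<and>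
     (\<forall>\<tau>. \<sigma> \<subseteq> \<tau> \<and> \<tau> \<subseteq> edges m n \<and> noncrossing \<tau> \<longrightarrow> \<tau> = \<sigma>)"

definition edge_at :: "edge set \<Rightarrow> point \<Rightarrow> edge" where
  "edge_at \<sigma> x = (THE e. e \<in> \<sigma> \<and> edge_midpoint e = x)"

text \<open>Only the values of \<open>\<eta>\<close> on \<open>\<Delta>\<close> matter.\<close>

definition constraints :: "nat \<Rightarrow> nat \<Rightarrow> (point \<Rightarrow> edge) \<Rightarrow> point set \<Rightarrow> bool" where
  "constraints m n \<eta> \<Delta> \<longleftrightarrow> \<Delta> \<subseteq> midpoints m n \<and>
     (\<forall>x\<in>\<Delta>. \<eta> x \<in> edges m n \<and> edge_midpoint (\<eta> x) = x) \<and> noncrossing (\<eta> ` \<Delta>)"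

definition Omega :: "nat \<Rightarrow> nat \<Rightarrow> (point \<Rightarrow> edge) \<Rightarrow> point set \<Rightarrow> edge set set" where
  "Omega m n \<eta> \<Delta> = {\<sigma>. triangulation m n \<sigma> \<and> (\<forall>x\<in>\<Delta>. edge_at \<sigma> x = \<eta> x)}"

definition total_length :: "nat \<Rightarrow> nat \<Rightarrow> edge set \<Rightarrow> real" where
  "total_length m n \<sigma> = (\<Sum>x\<in>midpoints m n. edge_length (edge_at \<sigma> x))"

definition partition_function ::
    "real \<Rightarrow> nat \<Rightarrow> nat \<Rightarrow> (point \<Rightarrow> edge) \<Rightarrow> point set \<Rightarrow> real" where
  "partition_function lam m n \<eta> \<Delta> = (\<Sum>\<sigma>\<in>Omega m n \<eta> \<Delta>. lam powr total_length m n \<sigma>)"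

text \<open>Well defined by \<open>pmf_gibbs\<close> below.\<close>

definition gibbs ::
    "real \<Rightarrow> nat \<Rightarrow> nat \<Rightarrow> (point \<Rightarrow> edge) \<Rightarrow> point set \<Rightarrow> edge set pmf" where
  "gibbs lam m n \<eta> \<Delta> = embed_pmf (\<lambda>\<sigma>. if \<sigma> \<in> Omega m n \<eta> \<Delta>
     then lam powr total_length m n \<sigma> / partition_function lam m n \<eta> \<Delta> else 0)"

text \<open>The triangles of \<open>\<sigma>\<close> are its faces: the last conjunct excludes three edges of \<open>\<sigma>\<close> that
  bound a triangle which \<open>\<sigma>\<close> subdivides further.\<close>

definition triangle_of :: "edge set \<Rightarrow> point \<Rightarrow> point \<Rightarrow> point \<Rightarrow> bool" where
  "triangle_of \<sigma> a b c \<longleftrightarrow> \<not> collinear {a, b, c} \<and> {a, b} \<in> \<sigma> \<and> {b, c} \<in> \<sigma> \<and> {a, c} \<in> \<sigma> \<and>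
     (\<forall>e\<in>\<sigma>. convex hull e \<inter> interior (convex hull {a, b, c}) = {})"

text \<open>The triangles \<open>abc\<close> and \<open>abd\<close> form a convex quadrilateral. Convexity of the union is not
  enough: if \<open>c\<close>, \<open>a\<close>, \<open>d\<close> are collinear the union is a triangle.\<close>

definition form_convex_quadrilateral :: "point \<Rightarrow> point \<Rightarrow> point \<Rightarrow> point \<Rightarrow> bool" where
  "form_convex_quadrilateral a b c d \<longleftrightarrow>
     convex (convex hull {a, b, c} \<union> convex hull {a, b, d}) \<and>
     (\<forall>p\<in>{a, b, c, d}. p extreme_point_of (convex hull {a, b, c, d}))"

definition flips_to :: "edge set \<Rightarrow> edge \<Rightarrow> edge \<Rightarrow> bool" where
  "flips_to \<sigma> e e' \<longleftrightarrow> (\<exists>a b c d. e = {a, b} \<and> e' = {c, d} \<and> c \<noteq> d \<and>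
     triangle_of \<sigma> a b c \<and> triangle_of \<sigma> a b d \<and> form_convex_quadrilateral a b c d)"

definition flippable :: "edge set \<Rightarrow> point \<Rightarrow> bool" where
  "flippable \<sigma> x \<longleftrightarrow> (\<exists>e'. flips_to \<sigma> (edge_at \<sigma> x) e')"

definition flipped_edge :: "edge set \<Rightarrow> point \<Rightarrow> edge" where
  "flipped_edge \<sigma> x = (THE e'. flips_to \<sigma> (edge_at \<sigma> x) e')"

definition flip :: "edge set \<Rightarrow> point \<Rightarrow> edge set" where
  "flip \<sigma> x = insert (flipped_edge \<sigma> x) (\<sigma> - {edge_at \<sigma> x})"

definition flip_prob :: "real \<Rightarrow> edge set \<Rightarrow> point \<Rightarrow> real" where
  "flip_prob lam \<sigma> x = lam powr edge_length (flipped_edge \<sigma> x) /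
     (lam powr edge_length (flipped_edge \<sigma> x) + lam powr edge_length (edge_at \<sigma> x))"

text \<open>If every midpoint is constrained there is nothing to pick and the chain stays put.\<close>

definition glauber_step ::
    "real \<Rightarrow> nat \<Rightarrow> nat \<Rightarrow> point set \<Rightarrow> edge set \<Rightarrow> edge set pmf" where
  "glauber_step lam m n \<Delta> \<sigma> =
     (if midpoints m n - \<Delta> = {} then return_pmf \<sigma>
      else bind_pmf (pmf_of_set (midpoints m n - \<Delta>)) (\<lambda>x.
        if flippable \<sigma> x
        then map_pmf (\<lambda>b. if b then flip \<sigma> x else \<sigma>) (bernoulli_pmf (flip_prob lam \<sigma> x))
        else return_pmf \<sigma>))"

primrec glauber_law ::
    "real \<Rightarrow> nat \<Rightarrow> nat \<Rightarrow> point set \<Rightarrow> nat \<Rightarrow> edge set \<Rightarrow> edge set pmf" where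
  "glauber_law lam m n \<Delta> 0 \<sigma> = return_pmf \<sigma>"
| "glauber_law lam m n \<Delta> (Suc t) \<sigma> = bind_pmf (glauber_law lam m n \<Delta> t \<sigma>) (glauber_step lam m n \<Delta>)"

definition tv_dist :: "'a pmf \<Rightarrow> 'a pmf \<Rightarrow> real" where
  "tv_dist p q = (SUP A. \<bar>measure_pmf.prob p A - measure_pmf.prob q A\<bar>)"

text \<open>The infimum is taken in \<open>enat\<close>, so that it is infinite if no such \<open>t\<close> exists.\<close>

definition mixing_time ::
    "real \<Rightarrow> nat \<Rightarrow> nat \<Rightarrow> (point \<Rightarrow> edge) \<Rightarrow> point set \<Rightarrow> enat" where
  "mixing_time lam m n \<eta> \<Delta> = Inf (enat ` {t.
     Max ((\<lambda>\<sigma>. tv_dist (glauber_law lam m n \<Delta> t \<sigma>) (gibbs lam m n \<eta> \<Delta>)) ` Omega m n \<eta> \<Delta>) \<le> 1 / 4})"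

lemma finite_edges: "finite (edges m n)"
proof -
  have "grid m n = (\<lambda>(i, j). (real i, real j)) ` ({..m} \<times> {..n})"
    by (auto simp: grid_def)
  then have "finite (grid m n)" by simp
  moreover have "edges m n \<subseteq> Pow (grid m n)" by (auto simp: edges_def)
  ultimately show ?thesis by (meson finite_Pow_iff finite_subset)
qed

lemma finite_Omega: "finite (Omega m n \<eta> \<Delta>)"
proof -
  have "Omega m n \<eta> \<Delta> \<subseteq> Pow (edges m n)" by (auto simp: Omega_def triangulation_def)
  then show ?thesis using finite_edges by (meson finite_Pow_iff finite_subset)
qed

lemma edge_midpoint_doubleton [simp]: "edge_midpoint {p, q} = midpoint p q"
  unfolding edge_midpoint_def
  by (rule the_equality) (blast, metis doubleton_eq_iff midpoint_sym)

lemma edge_length_doubleton [simp]: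
  "edge_length {p, q} = \<bar>fst p - fst q\<bar> + \<bar>snd p - snd q\<bar>"
  unfolding edge_length_def
  by (rule the_equality) (blast, auto simp: doubleton_eq_iff)

lemma edge_midpoint_in:
  assumes "e \<in> edges m n"
  shows "edge_midpoint e \<in> convex hull e" "edge_midpoint e \<notin> e"
proof -
  obtain p q where e: "e = {p, q}" "p \<noteq> q" using assms by (auto simp: edges_def)
  show "edge_midpoint e \<in> convex hull e" using e
    by (metis edge_midpoint_doubleton midpoint_in_closed_segment segment_convex_hull)
  show "edge_midpoint e \<notin> e" using e by auto
qed

lemma edge_at_eqI:
  assumes "\<sigma> \<subseteq> edges m n" "noncrossing \<sigma>" "e \<in> \<sigma>" "edge_midpoint e = x"
  shows "edge_at \<sigma> x = e"
  unfolding edge_at_def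
proof (rule the_equality)
  fix f assume f: "f \<in> \<sigma> \<and> edge_midpoint f = x"
  show "f = e"
  proof (rule ccontr)
    assume "f \<noteq> e"
    have ef: "e \<in> edges m n" "f \<in> edges m n" using assms f by auto
    have "x \<in> convex hull f" "x \<in> convex hull e" "x \<notin> f"
      using edge_midpoint_in[OF ef(1)] edge_midpoint_in[OF ef(2)] f assms(4) by simp_all
    with \<open>f \<noteq> e\<close> have "crosses f e" unfolding crosses_def by (intro conjI exI[of _ x]) simp_all
    then show False using assms f by (auto simp: noncrossing_def)
  qed
qed (use assms in auto)

lemma Omega_nonempty:
  assumes "constraints m n \<eta> \<Delta>"
  shows "Omega m n \<eta> \<Delta> \<noteq> {}"
proof -
  let ?S = "{\<tau>. \<eta> ` \<Delta> \<subseteq> \<tau> \<and> \<tau> \<subseteq> edges m n \<and> noncrossing \<tau>}"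
  have "finite ?S"
    by (rule finite_subset[of _ "Pow (edges m n)"]) (auto simp: finite_edges)
  moreover have "\<eta> ` \<Delta> \<in> ?S" using assms by (auto simp: constraints_def)
  ultimately have "\<exists>\<sigma>\<in>?S. \<eta> ` \<Delta> \<le> \<sigma> \<and> (\<forall>\<tau>\<in>?S. \<sigma> \<le> \<tau> \<longrightarrow> \<sigma> = \<tau>)"
    by (rule finite_has_maximal2)
  then obtain \<sigma> where \<sigma>: "\<sigma> \<in> ?S" "\<forall>\<tau>\<in>?S. \<sigma> \<subseteq> \<tau> \<longrightarrow> \<sigma> = \<tau>"
    by (elim bexE conjE)
  have "triangulation m n \<sigma>" unfolding triangulation_def
  proof (intro conjI allI impI)
    show "\<sigma> \<subseteq> edges m n" "noncrossing \<sigma>" using \<sigma>(1) by simp_all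
    fix \<tau> assume \<tau>: "\<sigma> \<subseteq> \<tau> \<and> \<tau> \<subseteq> edges m n \<and> noncrossing \<tau>"
    then have "\<tau> \<in> ?S" using \<sigma>(1) by auto
    then show "\<tau> = \<sigma>" using bspec[OF \<sigma>(2), of \<tau>] \<tau> by simp
  qed
  moreover have "edge_at \<sigma> x = \<eta> x" if "x \<in> \<Delta>" for x
    using \<sigma>(1) that assms by (intro edge_at_eqI[of _ m n]) (auto simp: constraints_def)
  ultimately show ?thesis by (auto simp: Omega_def)
qed

lemma pmf_gibbs:
  assumes "0 < lam" "constraints m n \<eta> \<Delta>"
  shows "pmf (gibbs lam m n \<eta> \<Delta>) \<sigma> = (if \<sigma> \<in> Omega m n \<eta> \<Delta>
     then lam powr total_length m n \<sigma> / partition_function lam m n \<eta> \<Delta> else 0)"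
proof -
  let ?O = "Omega m n \<eta> \<Delta>" and ?Z = "partition_function lam m n \<eta> \<Delta>"
  let ?f = "\<lambda>\<sigma>. if \<sigma> \<in> ?O then lam powr total_length m n \<sigma> / ?Z else 0"
  have Z: "?Z > 0" unfolding partition_function_def
    using assms finite_Omega Omega_nonempty by (intro sum_pos) auto
  have "(\<integral>\<^sup>+ \<sigma>. ennreal (?f \<sigma>) \<partial>count_space UNIV) = (\<integral>\<^sup>+ \<sigma>. ennreal (?f \<sigma>) \<partial>count_space ?O)"
    by (simp add: nn_integral_count_space_indicator) (rule nn_integral_cong, auto)
  also have "\<dots> = (\<Sum>\<sigma>\<in>?O. ennreal (?f \<sigma>))"
    by (rule nn_integral_count_space_finite[OF finite_Omega])
  also have "\<dots> = ennreal (\<Sum>\<sigma>\<in>?O. ?f \<sigma>)"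
    using Z by (intro sum_ennreal) auto
  also have "(\<Sum>\<sigma>\<in>?O. ?f \<sigma>) = ?Z / ?Z"
    unfolding partition_function_def sum_divide_distrib by (rule sum.cong) auto
  finally have "(\<integral>\<^sup>+ \<sigma>. ennreal (?f \<sigma>) \<partial>count_space UNIV) = 1" using Z by simp
  then show ?thesis unfolding gibbs_def using Z by (intro pmf_embed_pmf) auto
qed

end

theory Submission
  imports Defs
begin

text \<open>
  The vertical unit edges on both sides of the strip, the rails, belong to every triangulation. The
  other edges are rungs, one for each midpoint \<open>(1 / 2, k / 2)\<close> with \<open>0 \<le> k \<le> 2 n\<close>, and a rung is
  determined by the height difference \<open>d k\<close> of its ends. Two rungs cross iff \<open>\<bar>d' - d\<bar> > \<bar>k' - k\<bar>\<close>
  (\<open>crosses_rung_iff\<close>), so triangulations are the same as bridges: functions \<open>d\<close> with steps \<open>\<plusminus>1\<close> that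
  vanish at both ends (\<open>triangulation_ladder\<close>, \<open>triangulation_is_ladder\<close>). The rung at \<open>k\<close> has length
  \<open>1 + \<bar>d k\<bar>\<close>; it is flippable iff \<open>k\<close> is a local extremum of \<open>d\<close>, and the flip exchanges a maximum
  with a minimum (\<open>flips_to_ladder\<close>, \<open>ladder_flips_to\<close>). Constraints pin some values of \<open>d\<close>. The Glauber
  dynamics is thus the single-site heat-bath chain for bridges with weight \<open>\<lambda> ^ (\<Sum>k. \<bar>d k\<bar>)\<close>.

  This chain contracts a suitable metric for every \<open>\<lambda> < 1\<close>. Give a flip between neighbours of height
  \<open>h\<close> the size \<open>\<lambda> ^ - \<bar>h\<bar>\<close>. Suppose that a function changes by at most \<open>L\<close> times the size under every
  flip. Apply one step of the chain to it and compare the result at two bridges that differ by one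
  flip. If the site of the flip is updated, the difference disappears. If one of its two neighbours is
  updated, a new flip, now around \<open>h + 1\<close> or \<open>h - 1\<close>, may be needed; its probability times its size is
  at most \<open>\<lambda> / (1 + \<lambda>\<^sup>2) < 1 / 2\<close> times the original size, since moves away from height \<open>0\<close> are unlikely
  and moves towards it are small (\<open>up_weight_le\<close>). Other updates do no harm. If \<open>M\<close> midpoints are
  unconstrained, the Lipschitz constant therefore drops by the factor \<open>1 - gap \<lambda> / M\<close> in each step,
  where \<open>gap \<lambda> = 1 - 2 \<lambda> / (1 + \<lambda>\<^sup>2) > 0\<close> depends on \<open>\<lambda>\<close> only (\<open>flip_lipschitz_one_step\<close>).

  This is the dual form of path coupling: starting with the indicator of an event, the probability
  of the event after \<open>t\<close> steps depends on the initial state by at most \<open>(1 - gap \<lambda> / M) ^ t\<close> times the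
  diameter of the state space (\<open>flip_lipschitz_diff_le\<close>). Since the Gibbs distribution is stationary
  (\<open>bridge_weight_stationary\<close>), the same bound holds for the distance to it. The diameter is at most
  \<open>\<lambda> ^ (- 2 n)\<close> times a polynomial in \<open>n\<close>, hence exponential in \<open>n\<close>, and \<open>M\<close> is of order \<open>n\<close>, so that
  a number of steps of order \<open>n \<cdot> n\<close> suffices.
\<close>

section \<open>Bridges and their flips\<close>

definition bridge :: "int \<Rightarrow> (int \<Rightarrow> int) \<Rightarrow> bool" where
  "bridge N d \<longleftrightarrow> (\<forall>k. k \<le> 0 \<or> N \<le> k \<longrightarrow> d k = 0) \<and> (\<forall>k\<in>{0..<N}. \<bar>d (k + 1) - d k\<bar> = 1)"

definition corner :: "(int \<Rightarrow> int) \<Rightarrow> int \<Rightarrow> bool" where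
  "corner d k \<longleftrightarrow> d (k - 1) = d (k + 1)"

definition flip_at :: "(int \<Rightarrow> int) \<Rightarrow> int \<Rightarrow> int \<Rightarrow> int" where
  "flip_at d k = d(k := d (k - 1) + d (k + 1) - d k)"

definition pinned_bridges :: "int \<Rightarrow> int set \<Rightarrow> (int \<Rightarrow> int) \<Rightarrow> (int \<Rightarrow> int) set" where
  "pinned_bridges N K c = {d. bridge N d \<and> (\<forall>k\<in>K. d k = c k)}"

lemma flip_at_apply: "flip_at d k j = (if j = k then d (k - 1) + d (k + 1) - d k else d j)"
  by (simp add: flip_at_def)

lemma flip_at_flip_at [simp]: "flip_at (flip_at d k) k = d"
  by (auto simp: flip_at_def fun_eq_iff)

lemma corner_flip_at [simp]: "corner (flip_at d k) k \<longleftrightarrow> corner d k"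
  by (simp add: corner_def flip_at_def)

lemma bridge_outside: "bridge N d \<Longrightarrow> k \<le> 0 \<or> N \<le> k \<Longrightarrow> d k = 0"
  by (auto simp: bridge_def)

lemma bridge_step: "bridge N d \<Longrightarrow> 0 \<le> k \<Longrightarrow> k < N \<Longrightarrow> d (k + 1) = d k + 1 \<or> d (k + 1) = d k - 1"
  unfolding bridge_def by (smt (verit) atLeastLessThan_iff)

lemma bridge_step_back:
  "bridge N d \<Longrightarrow> 0 < k \<Longrightarrow> k \<le> N \<Longrightarrow> d (k - 1) = d k + 1 \<or> d (k - 1) = d k - 1"
  using bridge_step[of N d "k - 1"] by auto

lemma bridge_lipschitz_aux:
  assumes "bridge N d" "k \<le> k'"
  shows "\<bar>d k' - d k\<bar> \<le> k' - k"
  using assms(2)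
proof (induction k' rule: int_ge_induct)
  case (step i)
  have "\<bar>d (i + 1) - d i\<bar> \<le> 1"
    using bridge_step[OF assms(1), of i] bridge_outside[OF assms(1), of i]
      bridge_outside[OF assms(1), of "i + 1"]
    by (cases "0 \<le> i \<and> i < N") auto
  with step show ?case by linarith
qed simp

lemma bridge_lipschitz: "bridge N d \<Longrightarrow> \<bar>d k' - d k\<bar> \<le> \<bar>k' - k\<bar>"
  using bridge_lipschitz_aux[of N d k k'] bridge_lipschitz_aux[of N d k' k] by linarith

lemma bridge_abs_le: "bridge N d \<Longrightarrow> 0 \<le> k \<Longrightarrow> \<bar>d k\<bar> \<le> k"
  using bridge_lipschitz[of N d k 0] bridge_outside[of N d 0] by simp

lemma bridge_abs_le': "bridge N d \<Longrightarrow> k \<le> N \<Longrightarrow> \<bar>d k\<bar> \<le> N - k"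
  using bridge_lipschitz[of N d k N] bridge_outside[of N d N] by simp

lemma bridge_abs_le_length: "bridge N d \<Longrightarrow> 0 \<le> N \<Longrightarrow> \<bar>d k\<bar> \<le> N"
  using bridge_abs_le[of N d k] bridge_abs_le'[of N d k] bridge_outside[of N d k]
  by (cases "0 \<le> k \<and> k \<le> N") auto

text \<open>Steps are \<open>\<plusminus>1\<close>, so the parity of the height is forced. Hence two bridges that differ at a
  site differ there by at least two, and a rung built from a bridge has integral endpoints.\<close>

lemma bridge_parity:
  assumes "bridge N d" "0 \<le> k" "k \<le> N"
  shows "even (k - d k)"
  using assms(2,3)
proof (induction k rule: int_ge_induct)
  case base then show ?case using bridge_outside[OF assms(1), of 0] by simp
next
  case (step i)
  then show ?case using bridge_step[OF assms(1), of i] by auto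
qed

text \<open>At a corner both neighbours sit at the same height, so reflecting the height between them
  reverses two steps and keeps their size.\<close>

lemma flip_at_pinned_bridges:
  assumes d: "d \<in> pinned_bridges N K c" and k: "k \<in> {1..<N} - K" and cor: "corner d k"
  shows "flip_at d k \<in> pinned_bridges N K c"
proof -
  have b: "bridge N d" using d by (simp add: pinned_bridges_def)
  have "\<bar>flip_at d k (j + 1) - flip_at d k j\<bar> = 1" if "0 \<le> j" "j < N" for j
  proof -
    consider "j = k" | "j = k - 1" | "j \<noteq> k \<and> j + 1 \<noteq> k" by linarith
    then show ?thesis
    proof cases
      case 1 then show ?thesis using cor bridge_step_back[OF b, of k] k
        by (auto simp: flip_at_apply corner_def)
    next
      case 2 then show ?thesis using cor bridge_step[OF b, of k] k
        by (auto simp: flip_at_apply corner_def)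
    next
      case 3 then show ?thesis using bridge_step[OF b, of j] that by (auto simp: flip_at_apply)
    qed
  qed
  then show ?thesis using d k by (auto simp: pinned_bridges_def bridge_def flip_at_apply)
qed

lemma finite_pinned_bridges: "finite (pinned_bridges N K c)"
proof (rule finite_subset)
  let ?S = "\<Pi>\<^sub>E k\<in>{0..N}. {- \<bar>N\<bar>..\<bar>N\<bar>}"
  show "pinned_bridges N K c \<subseteq> (\<lambda>g k. if k \<in> {0..N} then g k else 0) ` ?S"
  proof
    fix d assume "d \<in> pinned_bridges N K c"
    then have b: "bridge N d" by (simp add: pinned_bridges_def)
    have "d k \<in> {- \<bar>N\<bar>..\<bar>N\<bar>}" if "k \<in> {0..N}" for k
      using bridge_abs_le_length[OF b, of k] that by auto
    then have "restrict d {0..N} \<in> ?S" by auto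
    moreover have "d = (\<lambda>k. if k \<in> {0..N} then restrict d {0..N} k else 0)"
      using bridge_outside[OF b] by (auto simp: fun_eq_iff)
    ultimately show "d \<in> (\<lambda>g k. if k \<in> {0..N} then g k else 0) ` ?S" by blast
  qed
  show "finite ((\<lambda>g k. if k \<in> {0..N} then g k else (0::int)) ` ?S)"
    by (intro finite_imageI finite_PiE) auto
qed

section \<open>Contraction of the heat-bath operator\<close>

text \<open>The probability that an update of the site \<open>k\<close> flips \<open>d\<close> there, for the weight
  \<open>\<lambda> ^ (\<Sum>k. \<bar>d k\<bar>)\<close> on bridges; all other factors of the weight cancel.\<close>

definition flip_weight :: "real \<Rightarrow> (int \<Rightarrow> int) \<Rightarrow> int \<Rightarrow> real" where
  "flip_weight lam d k =
     lam ^ nat \<bar>flip_at d k k\<bar> / (lam ^ nat \<bar>flip_at d k k\<bar> + lam ^ nat \<bar>d k\<bar>)"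

definition jump :: "real \<Rightarrow> ((int \<Rightarrow> int) \<Rightarrow> real) \<Rightarrow> (int \<Rightarrow> int) \<Rightarrow> int \<Rightarrow> real" where
  "jump lam f d k = (if corner d k then flip_weight lam d k * (f (flip_at d k) - f d) else 0)"

text \<open>The Markov operator of the chain, acting on functions: \<open>M\<close> sites are proposed with equal
  probability, and those outside \<open>F\<close> do nothing.\<close>

definition one_step ::
    "real \<Rightarrow> nat \<Rightarrow> int set \<Rightarrow> ((int \<Rightarrow> int) \<Rightarrow> real) \<Rightarrow> (int \<Rightarrow> int) \<Rightarrow> real" where
  "one_step lam M F f d = f d + (\<Sum>k\<in>F. jump lam f d k) / M"

text \<open>Lipschitz continuity along single flips, where a flip between neighbours of height \<open>h\<close> is given
  the size \<open>\<lambda> ^ - \<bar>h\<bar>\<close>. With all flips of size one the operator need not contract: for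
  \<open>\<bar>h\<bar> \<ge> 2\<close> an update of either neighbour can spread a discrepancy towards \<open>0\<close> with probability above
  one half. With exponential sizes such a move is cheap, while moves away from \<open>0\<close> are rare enough to
  outweigh their larger size.\<close>

definition flip_lipschitz ::
    "real \<Rightarrow> int \<Rightarrow> int set \<Rightarrow> (int \<Rightarrow> int) \<Rightarrow> real \<Rightarrow> ((int \<Rightarrow> int) \<Rightarrow> real) \<Rightarrow> bool" where
  "flip_lipschitz lam N K c L f \<longleftrightarrow>
     (\<forall>d\<in>pinned_bridges N K c. \<forall>k\<in>{1..<N} - K. corner d k \<longrightarrow>
        \<bar>f (flip_at d k) - f d\<bar> \<le> L * (1 / lam) ^ nat \<bar>d (k - 1)\<bar>)"

definition bridge_weight :: "real \<Rightarrow> int \<Rightarrow> (int \<Rightarrow> int) \<Rightarrow> real" where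
  "bridge_weight lam N d = (\<Prod>k\<in>{0..N}. lam ^ nat \<bar>d k\<bar>)"

text \<open>This is \<open>(1 - \<lambda>)\<^sup>2 / (1 + \<lambda>\<^sup>2)\<close>: one site heals a discrepancy, and each of its two neighbours
  spreads at most the fraction \<open>\<lambda> / (1 + \<lambda>\<^sup>2)\<close> of it.\<close>

definition gap :: "real \<Rightarrow> real" where
  "gap lam = 1 - 2 * (lam / (1 + lam\<^sup>2))"

context
  fixes lam :: real
  assumes lam: "0 < lam" "lam < 1"
begin

lemma flip_weight_bounds: "0 \<le> flip_weight lam d k" "flip_weight lam d k \<le> 1"
  using lam by (auto simp: flip_weight_def divide_simps add_nonneg_pos add_pos_pos)

lemma flip_weight_flip_at: "flip_weight lam d k + flip_weight lam (flip_at d k) k = 1"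
proof -
  have "lam ^ nat \<bar>flip_at d k k\<bar> + lam ^ nat \<bar>d k\<bar> > 0" using lam by (simp add: add_pos_pos)
  then show ?thesis by (simp add: flip_weight_def add.commute flip: add_divide_distrib)
qed

text \<open>The choice of the flip size \<open>\<lambda> ^ - \<bar>h\<bar>\<close> rests on this inequality. The left factor is the
  probability \<open>p\<close> of moving up from \<open>h - 1\<close> to \<open>h + 1\<close>. For \<open>h \<ge> 1\<close> it is \<open>\<lambda>\<^sup>2 / (1 + \<lambda>\<^sup>2)\<close> while the size
  grows by \<open>1 / \<lambda>\<close>; for \<open>h \<le> -1\<close> it is \<open>1 / (1 + \<lambda>\<^sup>2)\<close> while the size shrinks by \<open>\<lambda>\<close>. Both products equal
  \<open>\<lambda> / (1 + \<lambda>\<^sup>2)\<close>; for \<open>h = 0\<close> there is room to spare, since \<open>p = 1 / 2\<close>.\<close>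

lemma up_weight_le:
  "lam ^ nat \<bar>h + 1\<bar> / (lam ^ nat \<bar>h + 1\<bar> + lam ^ nat \<bar>h - 1\<bar>) * (1 / lam) ^ nat \<bar>h\<bar>
     \<le> lam / (1 + lam\<^sup>2) * (1 / lam) ^ nat \<bar>h - 1\<bar>" for h :: int
proof -
  have pos: "1 + lam\<^sup>2 > 0" using lam by (simp add: add_pos_nonneg)
  consider "h = 0" | m where "h = 1 + int m" | m where "h = - 1 - int m"
  proof -
    have "h = 0 \<or> h = 1 + int (nat (h - 1)) \<or> h = - 1 - int (nat (- h - 1))" by linarith
    then show thesis using that by blast
  qed
  then show ?thesis
  proof cases
    case 1
    have "lam\<^sup>2 \<le> 1" using lam by (simp add: power_le_one)
    then show ?thesis using 1 lam pos by (simp add: field_simps power2_eq_square)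
  next
    case 2
    have "nat \<bar>h + 1\<bar> = m + 2" "nat \<bar>h - 1\<bar> = m" "nat \<bar>h\<bar> = m + 1" using 2 by auto
    moreover have "x * lam\<^sup>2 / (x * lam\<^sup>2 + x) * (1 / x * (1 / lam)) = lam / (1 + lam\<^sup>2) * (1 / x)"
      if "x = lam ^ m" for x
    proof -
      have "x > 0" using that lam by simp
      moreover have "x * lam\<^sup>2 + x = x * (1 + lam\<^sup>2)" by (simp add: algebra_simps)
      ultimately show ?thesis using lam pos by (simp add: divide_simps) (simp add: power2_eq_square)
    qed
    ultimately show ?thesis by (simp only: power_add power_one_over power_one_right order_refl)
  next
    case 3
    have "nat \<bar>h + 1\<bar> = m" "nat \<bar>h - 1\<bar> = m + 2" "nat \<bar>h\<bar> = m + 1" using 3 by auto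
    moreover have "x / (x + x * lam\<^sup>2) * (1 / x * (1 / lam)) = lam / (1 + lam\<^sup>2) * (1 / x * (1 / lam\<^sup>2))"
      if "x = lam ^ m" for x
    proof -
      have "x > 0" using that lam by simp
      moreover have "x + x * lam\<^sup>2 = x * (1 + lam\<^sup>2)" by (simp add: algebra_simps)
      ultimately show ?thesis using lam pos by (simp add: divide_simps) (simp add: power2_eq_square)
    qed
    ultimately show ?thesis by (simp only: power_add power_one_over power_one_right order_refl)
  qed
qed

text \<open>The form in which the inequality is applied: \<open>j\<close> is a neighbour of a discrepancy between
  neighbours of height \<open>h\<close>, so \<open>j\<close> itself has height \<open>h\<close> and would flip around \<open>h + 1\<close> or \<open>h - 1\<close>.
  The second case is the reflection \<open>h \<mapsto> -h\<close> of the first.\<close>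

lemma outward_weight_le:
  assumes "corner d j" "d j = h" "\<bar>d (j - 1) - h\<bar> = 1"
  shows "flip_weight lam d j * (1 / lam) ^ nat \<bar>d (j - 1)\<bar>
           \<le> lam / (1 + lam\<^sup>2) * (1 / lam) ^ nat \<bar>h\<bar>"
proof -
  have new: "flip_at d j j = 2 * d (j - 1) - h"
    using assms by (simp add: flip_at_apply corner_def)
  consider "d (j - 1) = h + 1" | "d (j - 1) = h - 1" using assms(3) by linarith
  then show ?thesis
  proof cases
    case 1
    then have "flip_at d j j = (h + 1) + 1" "d j = (h + 1) - 1" using new assms(2) by auto
    then show ?thesis using up_weight_le[of "h + 1"] 1 by (simp add: flip_weight_def)
  next
    case 2
    then have "\<bar>flip_at d j j\<bar> = \<bar>(1 - h) + 1\<bar>" "\<bar>d j\<bar> = \<bar>(1 - h) - 1\<bar>"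
      "\<bar>d (j - 1)\<bar> = \<bar>1 - h\<bar>" "\<bar>h\<bar> = \<bar>(1 - h) - 1\<bar>" using new assms(2) by auto
    then show ?thesis using up_weight_le[of "1 - h"] by (simp only: flip_weight_def)
  qed
qed

text \<open>After an update of \<open>k\<close> the law no longer depends on the old height there: the two jumps undo
  the difference completely.\<close>

lemma jump_flip_at: "jump lam f (flip_at d k) k - jump lam f d k =
    (if corner d k then f d - f (flip_at d k) else 0)"
proof (cases "corner d k")
  case True
  let ?p = "flip_weight lam d k"
  have "flip_weight lam (flip_at d k) k = 1 - ?p" using flip_weight_flip_at[of d k] by linarith
  then show ?thesis using True by (simp add: jump_def) (simp add: algebra_simps)
qed (simp add: jump_def)

text \<open>Let \<open>e\<close> be the flip of \<open>d\<close> at \<open>k\<close>, between neighbours of height \<open>h\<close>. Updating \<open>k\<close> removes the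
  difference. Updating a site at distance at least two commutes with the flip, so it does not
  enlarge the difference. At \<open>k \<plusminus> 1\<close> at most one of \<open>d\<close>, \<open>e\<close> has a corner, and its possible flip costs at
  most \<open>\<lambda> / (1 + \<lambda>\<^sup>2)\<close> of the size of the original one. A pinned neighbour
  spreads nothing.\<close>

lemma flip_lipschitz_one_step:
  assumes f: "flip_lipschitz lam N K c L f" and L: "0 \<le> L"
    and M: "card ({1..<N} - K) \<le> M" "0 < M"
  shows "flip_lipschitz lam N K c (L * (1 - gap lam / M))
           (one_step lam M ({1..<N} - K) f)"
  unfolding flip_lipschitz_def gap_def
proof (intro ballI impI)
  fix d k
  let ?P = "pinned_bridges N K c" and ?F = "{1..<N} - K"
  let ?kap = "lam / (1 + lam\<^sup>2)"
  assume d: "d \<in> ?P" and k: "k \<in> ?F" and cor: "corner d k"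
  define h where "h = d (k - 1)"
  define e where "e = flip_at d k"
  define w where "w = L * (1 / lam) ^ nat \<bar>h\<bar>"
  have w: "0 \<le> w" using L lam by (simp add: w_def)
  have kap: "0 \<le> ?kap" using lam by simp
  have e: "e \<in> ?P" using flip_at_pinned_bridges[OF d k cor] by (simp add: e_def)
  have fed: "\<bar>f e - f d\<bar> \<le> w"
    using f d k cor by (auto simp: flip_lipschitz_def e_def w_def h_def)
  have bd: "bridge N d" and be: "bridge N e" using d e by (auto simp: pinned_bridges_def)
  have h': "d (k + 1) = h" using cor by (simp add: corner_def h_def)
  have ed: "e j = d j" if "j \<noteq> k" for j using that by (simp add: e_def flip_at_apply)
  have ek: "e k = 2 * h - d k" using h' by (simp add: e_def flip_at_apply h_def)
  have dk: "\<bar>d k - h\<bar> = 1" using bridge_step_back[OF bd, of k] k by (auto simp: h_def)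
  \<comment> \<open>A neighbour of \<open>k\<close> has height \<open>h\<close>, so its only possible flip is one around \<open>h \<plusminus> 1\<close>.\<close>
  have outward: "\<bar>jump lam f g j\<bar> \<le> ?kap * w"
    if g: "g \<in> ?P" and j: "j \<in> ?F" and gj: "g j = h" "\<bar>g (j - 1) - h\<bar> = 1" for g j
  proof (cases "corner g j")
    case True
    have "\<bar>jump lam f g j\<bar> = flip_weight lam g j * \<bar>f (flip_at g j) - f g\<bar>"
      using True flip_weight_bounds[of g j] by (simp add: jump_def abs_mult)
    also have "\<dots> \<le> flip_weight lam g j * (L * (1 / lam) ^ nat \<bar>g (j - 1)\<bar>)"
      using f g j True flip_weight_bounds[of g j]
      by (intro mult_left_mono) (auto simp: flip_lipschitz_def)
    also have "\<dots> = L * (flip_weight lam g j * (1 / lam) ^ nat \<bar>g (j - 1)\<bar>)" by simp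
    also have "\<dots> \<le> L * (?kap * (1 / lam) ^ nat \<bar>h\<bar>)"
      using outward_weight_le[OF True gj] L by (intro mult_left_mono)
    finally show ?thesis by (simp add: w_def mult_ac)
  next
    case False
    then show ?thesis using mult_nonneg_nonneg[OF kap w] by (simp add: jump_def)
  qed
  have at_k: "(f e - f d) + (jump lam f e k - jump lam f d k) = 0"
    using jump_flip_at[of f d k] cor by (simp add: e_def)
  \<comment> \<open>The flips at \<open>j\<close> and \<open>k\<close> commute, so the update mixes two differences that are both at most \<open>w\<close>.\<close>
  have far: "\<bar>(f e - f d) + (jump lam f e j - jump lam f d j)\<bar> \<le> w"
    if j: "j \<in> ?F" "j \<noteq> k" "j \<noteq> k - 1" "j \<noteq> k + 1" for j
  proof (cases "corner d j")
    case True
    have ce: "corner e j" using True that ed by (auto simp: corner_def)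
    have p: "flip_weight lam e j = flip_weight lam d j"
      using that ed by (simp add: flip_weight_def flip_at_apply)
    have comm: "flip_at e j = flip_at (flip_at d j) k"
      using j by (auto simp: e_def flip_at_def fun_eq_iff)
    have "flip_at d j \<in> ?P" using flip_at_pinned_bridges[OF d j(1) True] .
    moreover have "corner (flip_at d j) k" "flip_at d j (k - 1) = h"
      using cor j by (auto simp: corner_def flip_at_apply h_def)
    ultimately have "\<bar>f (flip_at e j) - f (flip_at d j)\<bar> \<le> w"
      using f k unfolding comm w_def by (auto simp: flip_lipschitz_def)
    then have "\<bar>flip_weight lam d j * (f (flip_at e j) - f (flip_at d j))\<bar> \<le> flip_weight lam d j * w"
      "\<bar>(1 - flip_weight lam d j) * (f e - f d)\<bar> \<le> (1 - flip_weight lam d j) * w"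
      using fed flip_weight_bounds[of d j] by (auto simp: abs_mult intro!: mult_left_mono)
    then have "\<bar>flip_weight lam d j * (f (flip_at e j) - f (flip_at d j))
        + (1 - flip_weight lam d j) * (f e - f d)\<bar> \<le> flip_weight lam d j * w + (1 - flip_weight lam d j) * w"
      by linarith
    moreover have "(f e - f d) + (jump lam f e j - jump lam f d j)
        = flip_weight lam d j * (f (flip_at e j) - f (flip_at d j))
          + (1 - flip_weight lam d j) * (f e - f d)"
      using True ce p by (simp add: jump_def algebra_simps)
    moreover have "flip_weight lam d j * w + (1 - flip_weight lam d j) * w = w"
      by (simp add: algebra_simps)
    ultimately show ?thesis by (simp only:)
  next
    case False
    then have "\<not> corner e j" using that ed by (auto simp: corner_def)
    then show ?thesis using False fed by (simp add: jump_def)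
  qed
  \<comment> \<open>The heights of \<open>d\<close> and \<open>e\<close> at \<open>k\<close> differ, so \<open>j\<close> is a corner of at most one of the two.\<close>
  have near: "\<bar>(f e - f d) + (jump lam f e j - jump lam f d j)\<bar> \<le> w + ?kap * w"
    if j: "j \<in> ?F" "j = k - 1 \<or> j = k + 1" for j
  proof -
    have dj: "d j = h" "e j = h" using j h' ed by (auto simp: h_def)
    have ndiff: "\<not> corner d j \<or> \<not> corner e j"
      using j dk ek ed by (auto simp: corner_def)
    have J: "\<bar>jump lam f d j\<bar> \<le> ?kap * w" "\<bar>jump lam f e j\<bar> \<le> ?kap * w"
      using outward[OF d j(1)] outward[OF e j(1)] dj
        bridge_step_back[OF bd, of j] bridge_step_back[OF be, of j] j by auto
    from ndiff have "jump lam f d j = 0 \<or> jump lam f e j = 0" by (auto simp: jump_def)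
    then show ?thesis using J fed by auto
  qed
  define b where "b j = (if j = k then 0 else w) + (if j = k - 1 then ?kap * w else 0)
    + (if j = k + 1 then ?kap * w else 0)" for j
  have bnd: "\<bar>(f e - f d) + (jump lam f e j - jump lam f d j)\<bar> \<le> b j" if "j \<in> ?F" for j
    using that at_k far[of j] near[of j] by (auto simp: b_def)
  have "(\<Sum>j\<in>?F. if j = k then 0 else w) = (\<Sum>j\<in>?F. w - (if j = k then w else 0))"
    by (intro sum.cong) auto
  also have "\<dots> = card ?F * w - w"
    using k by (simp add: sum_subtractf)
  finally have s1: "(\<Sum>j\<in>?F. if j = k then 0 else w) = card ?F * w - w" .
  have s2: "(\<Sum>j\<in>?F. if j = i then ?kap * w else 0) \<le> ?kap * w" for i
    using mult_nonneg_nonneg[OF kap w] by auto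
  have bsum: "(\<Sum>j\<in>?F. b j) \<le> card ?F * w - w + 2 * (?kap * w)"
    using s1 s2[of "k - 1"] s2[of "k + 1"] unfolding b_def sum.distrib by linarith
  define \<Sigma> where "\<Sigma> = (\<Sum>j\<in>?F. (f e - f d) + (jump lam f e j - jump lam f d j))"
  have \<Sigma>: "\<bar>\<Sigma>\<bar> \<le> card ?F * w - w + 2 * (?kap * w)"
    unfolding \<Sigma>_def using bnd bsum
    by (intro order.trans[OF sum_abs]) (meson order.trans sum_mono)
  have "M * (one_step lam M ?F f e - one_step lam M ?F f d)
      = (real M - card ?F) * (f e - f d) + \<Sigma>"
    using M(2) by (simp add: one_step_def \<Sigma>_def sum.distrib sum_subtractf field_simps)
  moreover have "\<bar>(real M - card ?F) * (f e - f d)\<bar> \<le> (real M - card ?F) * w"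
    using M fed by (simp add: abs_mult mult_left_mono)
  ultimately have "\<bar>M * (one_step lam M ?F f e - one_step lam M ?F f d)\<bar>
      \<le> (real M - card ?F) * w + (card ?F * w - w + 2 * (?kap * w))"
    using \<Sigma> abs_triangle_ineq[of "(real M - card ?F) * (f e - f d)" \<Sigma>] by linarith
  also have "\<dots> = M * (w * (1 - (1 - 2 * ?kap) / M))" using M(2) by (simp add: field_simps)
  finally have "M * \<bar>one_step lam M ?F f e - one_step lam M ?F f d\<bar>
      \<le> M * (w * (1 - (1 - 2 * ?kap) / M))" by (simp add: abs_mult)
  then have "\<bar>one_step lam M ?F f e - one_step lam M ?F f d\<bar> \<le> w * (1 - (1 - 2 * ?kap) / M)"
    using M(2) by (simp only: mult_le_cancel_left_pos of_nat_0_less_iff)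
  then show "\<bar>one_step lam M ?F f (flip_at d k) - one_step lam M ?F f d\<bar>
      \<le> L * (1 - (1 - 2 * ?kap) / M) * (1 / lam) ^ nat \<bar>d (k - 1)\<bar>"
    by (simp add: e_def w_def h_def mult_ac)
qed

text \<open>Any two bridges with the same pins are joined by a path of flips that shortens their
  \<open>\<ell>\<^sub>1\<close> distance by two at every step, and each flip has size at most \<open>\<lambda> ^ - N\<close>. This crude bound
  is exponential in \<open>N\<close>, which costs only a factor \<open>N\<close> in time because the contraction is
  geometric.\<close>

lemma flip_lipschitz_diff_le:
  assumes f: "flip_lipschitz lam N K c L f" and L: "0 \<le> L" and N: "0 \<le> N"
    and d: "d \<in> pinned_bridges N K c" and e: "e \<in> pinned_bridges N K c"
  shows "\<bar>f d - f e\<bar> \<le> L * (1 / lam) ^ nat N * real_of_int (\<Sum>k\<in>{0..N}. \<bar>d k - e k\<bar>)"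
  using d e
proof (induction "nat (\<Sum>k\<in>{0..N}. \<bar>d k - e k\<bar>)" arbitrary: d e rule: less_induct)
  case less
  let ?P = "pinned_bridges N K c" and ?F = "{1..<N} - K"
  let ?C = "L * (1 / lam) ^ nat N"
  let ?D = "\<lambda>d e :: int \<Rightarrow> int. \<Sum>k\<in>{0..N}. \<bar>d k - e k\<bar>"
  have C: "0 \<le> ?C" using L lam by simp
  \<comment> \<open>Lowering the upper bridge at a highest site of disagreement stays above the lower one.\<close>
  have descent: "\<bar>f u - f v\<bar> \<le> ?C * ?D u v"
    if u: "u \<in> ?P" and v: "v \<in> ?P" and uv: "?D u v = ?D d e" and ex: "\<exists>k. u k > v k" for u v
  proof -
    have bu: "bridge N u" and bv: "bridge N v" using u v by (auto simp: pinned_bridges_def)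
    let ?S = "{k \<in> {0..N}. u k > v k}"
    have inside: "k \<in> {1..<N} - K" if "u k > v k" for k
      using that bridge_outside[OF bu, of k] bridge_outside[OF bv, of k] u v
      by (force simp: pinned_bridges_def)
    have fS: "finite ?S" by (rule finite_subset[of _ "{0..N}"]) auto
    obtain j where "u j > v j" using ex by blast
    then have "j \<in> ?S" using inside[of j] by simp
    then have "Max (u ` ?S) \<in> u ` ?S" using fS by (intro Max_in) auto
    then obtain k where k: "k \<in> ?S" "u k = Max (u ` ?S)" by (elim imageE) simp
    have max: "u j \<le> u k" if "j \<in> ?S" for j
      unfolding k(2) using fS that by (intro Max_ge) auto
    have kF: "k \<in> ?F" using inside k(1) by auto
    have r: "u (k + 1) = u k - 1"
    proof (rule ccontr)
      assume "u (k + 1) \<noteq> u k - 1"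
      then have a: "u (k + 1) = u k + 1" using bridge_step[OF bu, of k] kF by auto
      have "k + 1 \<in> ?S" using a bridge_step[OF bv, of k] kF k(1) by auto
      then show False using max[of "k + 1"] a by linarith
    qed
    have l: "u (k - 1) = u k - 1"
    proof (rule ccontr)
      assume "u (k - 1) \<noteq> u k - 1"
      then have a: "u (k - 1) = u k + 1" using bridge_step_back[OF bu, of k] kF by auto
      have "k - 1 \<in> ?S" using a bridge_step_back[OF bv, of k] kF k(1) by auto
      then show False using max[of "k - 1"] a by linarith
    qed
    have cor: "corner u k" using l r by (simp add: corner_def)
    define g where "g = flip_at u k"
    have gk: "g j = (if j = k then u k - 2 else u j)" for j
      using l r by (simp add: g_def flip_at_apply)
    have g: "g \<in> ?P" unfolding g_def by (rule flip_at_pinned_bridges[OF u kF cor])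
    have "even (k - u k)" "even (k - v k)"
      using bridge_parity[OF bu, of k] bridge_parity[OF bv, of k] kF by auto
    moreover have "v k < u k" using k(1) by simp
    ultimately have gap: "u k \<ge> v k + 2" by presburger
    have kin: "k \<in> {0..N}" using kF by auto
    have "?D g v = \<bar>g k - v k\<bar> + (\<Sum>j\<in>{0..N} - {k}. \<bar>g j - v j\<bar>)"
      using kin by (simp add: sum.remove)
    also have "(\<Sum>j\<in>{0..N} - {k}. \<bar>g j - v j\<bar>) = (\<Sum>j\<in>{0..N} - {k}. \<bar>u j - v j\<bar>)"
      by (intro sum.cong) (auto simp: gk)
    finally have D: "?D g v = ?D u v - 2" using kin gap by (simp add: sum.remove gk)
    have "0 \<le> ?D g v" by (intro sum_nonneg) auto
    then have "\<bar>f g - f v\<bar> \<le> ?C * ?D g v"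
      using D uv by (intro less.hyps[OF _ g v]) simp
    moreover have "\<bar>f g - f u\<bar> \<le> ?C"
    proof -
      have "\<bar>f g - f u\<bar> \<le> L * (1 / lam) ^ nat \<bar>u (k - 1)\<bar>"
        using f u kF cor by (simp add: flip_lipschitz_def g_def)
      also have "\<dots> \<le> ?C"
        using L lam bridge_abs_le_length[OF bu N, of "k - 1"]
        by (intro mult_left_mono power_increasing) auto
      finally show ?thesis .
    qed
    moreover have "?C * ?D u v = ?C * ?D g v + 2 * ?C"
    proof -
      have "real_of_int (?D u v) = real_of_int (?D g v) + 2" using D by linarith
      then show ?thesis by (simp only: distrib_left mult.commute[of 2])
    qed
    ultimately show ?thesis using C by linarith
  qed
  show ?case
  proof (cases "d = e")
    case True then show ?thesis by simp
  next
    case False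
    then obtain k where "d k \<noteq> e k" by auto
    then consider "d k > e k" | "e k > d k" by linarith
    then show ?thesis
    proof cases
      case 1 then show ?thesis using descent[OF less.prems refl] by blast
    next
      case 2
      have sym: "?D e d = ?D d e" by (intro sum.cong) auto
      have "\<bar>f e - f d\<bar> \<le> ?C * ?D e d" using descent[OF less.prems(2,1) sym] 2 by blast
      then show ?thesis using sym by (simp add: abs_minus_commute)
    qed
  qed
qed

lemma pinned_bridges_dist_le:
  assumes "d \<in> pinned_bridges N K c" "e \<in> pinned_bridges N K c" "0 \<le> N"
  shows "(\<Sum>k\<in>{0..N}. \<bar>d k - e k\<bar>) \<le> (N + 1) * (2 * N)"
proof -
  have "(\<Sum>k\<in>{0..N}. \<bar>d k - e k\<bar>) \<le> (\<Sum>k\<in>{0..N}. 2 * N)"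
  proof (rule sum_mono)
    fix k
    have "\<bar>d k\<bar> \<le> N" "\<bar>e k\<bar> \<le> N"
      using assms by (auto simp: pinned_bridges_def intro: bridge_abs_le_length)
    then show "\<bar>d k - e k\<bar> \<le> 2 * N" by linarith
  qed
  then show ?thesis using assms(3) by simp
qed

lemma bridge_weight_pos: "0 < bridge_weight lam N d"
  using lam by (simp add: bridge_weight_def prod_pos)

lemma detailed_balance:
  assumes "k \<in> {0..N}"
  shows "bridge_weight lam N (flip_at d k) * flip_weight lam (flip_at d k) k
    = bridge_weight lam N d * flip_weight lam d k"
proof -
  define R where "R = (\<Prod>j\<in>{0..N} - {k}. lam ^ nat \<bar>d j\<bar>)"
  have "(\<Prod>j\<in>{0..N} - {k}. lam ^ nat \<bar>flip_at d k j\<bar>) = R"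
    unfolding R_def by (intro prod.cong) (auto simp: flip_at_apply)
  then have "bridge_weight lam N (flip_at d k) = lam ^ nat \<bar>flip_at d k k\<bar> * R"
    "bridge_weight lam N d = lam ^ nat \<bar>d k\<bar> * R"
    using assms by (auto simp: bridge_weight_def prod.remove[of _ k] R_def)
  then show ?thesis by (simp add: flip_weight_def add.commute)
qed

text \<open>Flipping at \<open>k\<close> is an involution on the bridges with a corner at \<open>k\<close>, and by detailed balance it
  reverses the sign of the weighted jump, so the jumps at \<open>k\<close> average to zero.\<close>

lemma bridge_weight_stationary:
  "(\<Sum>d\<in>pinned_bridges N K c. bridge_weight lam N d * one_step lam M ({1..<N} - K) f d)
     = (\<Sum>d\<in>pinned_bridges N K c. bridge_weight lam N d * f d)"
proof -
  let ?P = "pinned_bridges N K c" and ?F = "{1..<N} - K"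
  have zero: "(\<Sum>d\<in>?P. bridge_weight lam N d * jump lam f d k) = 0" if k: "k \<in> ?F" for k
  proof -
    let ?Q = "{d \<in> ?P. corner d k}"
    let ?g = "\<lambda>d. bridge_weight lam N d * flip_weight lam d k * (f (flip_at d k) - f d)"
    have kin: "k \<in> {0..N}" using k by auto
    have "(\<Sum>d\<in>?P. bridge_weight lam N d * jump lam f d k) = (\<Sum>d\<in>?Q. ?g d)"
      using finite_pinned_bridges by (intro sum.mono_neutral_cong_right) (auto simp: jump_def)
    moreover have "(\<Sum>d\<in>?Q. ?g d) = (\<Sum>d\<in>?Q. - ?g d)"
    proof (rule sum.reindex_bij_witness[of _ "\<lambda>d. flip_at d k" "\<lambda>d. flip_at d k"])
      show "- ?g (flip_at d k) = ?g d" for d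
        unfolding flip_at_flip_at detailed_balance[OF kin, of d] by (simp add: algebra_simps)
    qed (auto intro: flip_at_pinned_bridges[OF _ k])
    ultimately show ?thesis unfolding sum_negf by linarith
  qed
  have "bridge_weight lam N d * one_step lam M ?F f d
      = bridge_weight lam N d * f d + (\<Sum>k\<in>?F. bridge_weight lam N d * jump lam f d k) / M" for d
    by (simp add: one_step_def distrib_left flip: sum_distrib_left)
  then have "(\<Sum>d\<in>?P. bridge_weight lam N d * one_step lam M ?F f d)
      = (\<Sum>d\<in>?P. bridge_weight lam N d * f d)
        + (\<Sum>d\<in>?P. \<Sum>k\<in>?F. bridge_weight lam N d * jump lam f d k) / M"
    by (simp add: sum.distrib sum_divide_distrib)
  also have "(\<Sum>d\<in>?P. \<Sum>k\<in>?F. bridge_weight lam N d * jump lam f d k)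
      = (\<Sum>k\<in>?F. \<Sum>d\<in>?P. bridge_weight lam N d * jump lam f d k)"
    by (rule sum.swap)
  finally show ?thesis using zero by simp
qed

lemma gap_bounds: "0 < gap lam" "gap lam \<le> 1"
proof -
  have "0 < (1 - lam)\<^sup>2" using lam by simp
  then have "2 * lam < 1 + lam\<^sup>2" by (simp add: power2_eq_square algebra_simps)
  then show "0 < gap lam" using lam by (simp add: gap_def divide_simps)
  show "gap lam \<le> 1" using lam by (simp add: gap_def)
qed

text \<open>A function with values in \<open>[0, 1]\<close> is Lipschitz with constant one because every flip has size
  at least one. Iterating the operator shrinks the constant geometrically, hence the oscillation,
  while the weighted mean stays fixed.\<close>

lemma iterated_one_step_near_mean:
  assumes N: "0 \<le> N" and M: "card ({1..<N} - K) \<le> M" "0 < M"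
    and g0: "\<And>d. 0 \<le> g 0 d" "\<And>d. g 0 d \<le> 1"
    and step: "\<And>t d. d \<in> pinned_bridges N K c \<Longrightarrow> g (Suc t) d = one_step lam M ({1..<N} - K) (g t) d"
    and d: "d \<in> pinned_bridges N K c"
  shows "\<bar>g t d - (\<Sum>e\<in>pinned_bridges N K c. bridge_weight lam N e * g 0 e)
            / (\<Sum>e\<in>pinned_bridges N K c. bridge_weight lam N e)\<bar>
     \<le> (1 - gap lam / M) ^ t * ((1 / lam) ^ nat N * of_int ((N + 1) * (2 * N)))"
proof -
  let ?P = "pinned_bridges N K c" and ?F = "{1..<N} - K" and ?r = "1 - gap lam / M"
  let ?W = "bridge_weight lam N"
  have "gap lam / M \<le> 1" using gap_bounds M(2) by (simp add: divide_simps)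
  then have r: "0 \<le> ?r" by simp
  have lip: "flip_lipschitz lam N K c (?r ^ t) (g t)"
  proof (induction t)
    case 0
    show ?case unfolding flip_lipschitz_def
    proof (intro ballI impI)
      fix d k
      have "\<bar>g 0 (flip_at d k) - g 0 d\<bar> \<le> 1"
        using g0(1)[of d] g0(2)[of d] g0(1)[of "flip_at d k"] g0(2)[of "flip_at d k"] by linarith
      also have "1 \<le> (1 / lam) ^ nat \<bar>d (k - 1)\<bar>" using lam by (intro one_le_power) simp
      finally show "\<bar>g 0 (flip_at d k) - g 0 d\<bar> \<le> ?r ^ 0 * (1 / lam) ^ nat \<bar>d (k - 1)\<bar>" by simp
    qed
  next
    case (Suc t)
    have "flip_lipschitz lam N K c (?r ^ t * ?r) (one_step lam M ?F (g t))"
      using flip_lipschitz_one_step[OF Suc _ M] r by simp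
    then show ?case
      using step flip_at_pinned_bridges[of _ N K c] by (simp add: flip_lipschitz_def mult.commute)
  qed
  have diff: "\<bar>g t d - g t e\<bar> \<le> ?r ^ t * ((1 / lam) ^ nat N * of_int ((N + 1) * (2 * N)))"
    if e: "e \<in> ?P" for e
  proof -
    have "\<bar>g t d - g t e\<bar> \<le> ?r ^ t * (1 / lam) ^ nat N * real_of_int (\<Sum>k\<in>{0..N}. \<bar>d k - e k\<bar>)"
      using flip_lipschitz_diff_le[OF lip _ N d e] r by simp
    also have "\<dots> \<le> ?r ^ t * (1 / lam) ^ nat N * real_of_int ((N + 1) * (2 * N))"
      using r lam pinned_bridges_dist_le[OF d e N] by (intro mult_left_mono) (simp_all only: of_int_le_iff, simp)
    finally show ?thesis by (simp only: mult.assoc)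
  qed
  have stat: "(\<Sum>e\<in>?P. ?W e * g t e) = (\<Sum>e\<in>?P. ?W e * g 0 e)" for t
  proof (induction t)
    case (Suc t)
    have "(\<Sum>e\<in>?P. ?W e * g (Suc t) e) = (\<Sum>e\<in>?P. ?W e * one_step lam M ?F (g t) e)"
      using step by (intro sum.cong) auto
    then show ?case using bridge_weight_stationary[where N = N and K = K and c = c and M = M and f = "g t"] Suc by simp
  qed simp
  define Z where "Z = (\<Sum>e\<in>?P. ?W e)"
  have Z: "0 < Z" unfolding Z_def using d finite_pinned_bridges bridge_weight_pos by (intro sum_pos) auto
  let ?D = "?r ^ t * ((1 / lam) ^ nat N * of_int ((N + 1) * (2 * N)))"
  have "Z * g t d - (\<Sum>e\<in>?P. ?W e * g 0 e) = (\<Sum>e\<in>?P. ?W e * (g t d - g t e))"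
    unfolding stat[of t, symmetric] Z_def by (simp add: right_diff_distrib sum_subtractf sum_distrib_right)
  then have "\<bar>Z * g t d - (\<Sum>e\<in>?P. ?W e * g 0 e)\<bar> \<le> (\<Sum>e\<in>?P. \<bar>?W e * (g t d - g t e)\<bar>)"
    by (simp only: sum_abs)
  also have "\<dots> \<le> (\<Sum>e\<in>?P. ?W e * ?D)"
    using diff bridge_weight_pos by (intro sum_mono) (simp add: abs_mult less_imp_le)
  also have "\<dots> = Z * ?D" by (simp only: Z_def sum_distrib_right)
  finally have *: "\<bar>Z * g t d - (\<Sum>e\<in>?P. ?W e * g 0 e)\<bar> \<le> Z * ?D" .
  have "g t d - (\<Sum>e\<in>?P. ?W e * g 0 e) / Z = (Z * g t d - (\<Sum>e\<in>?P. ?W e * g 0 e)) / Z"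
    using Z by (simp add: field_simps)
  then have "\<bar>g t d - (\<Sum>e\<in>?P. ?W e * g 0 e) / Z\<bar> = \<bar>Z * g t d - (\<Sum>e\<in>?P. ?W e * g 0 e)\<bar> / Z"
    using Z by simp
  also have "\<dots> \<le> Z * ?D / Z" using * Z by (intro divide_right_mono) auto
  finally show ?thesis using Z by (simp add: Z_def)
qed

end

section \<open>Triangulations of the strip as bridges\<close>

text \<open>The edge with midpoint \<open>(1 / 2, k / 2)\<close> whose right end is \<open>d\<close> higher than its left end.\<close>

definition rung :: "int \<Rightarrow> int \<Rightarrow> edge" where
  "rung k d = {(0, of_int (k - d) / 2), (1, of_int (k + d) / 2)}"

text \<open>The vertical unit edges, which belong to every triangulation of the strip.\<close>

definition rails :: "nat \<Rightarrow> edge set" where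
  "rails n = {{(x, real j), (x, real j + 1)} |x j. (x = 0 \<or> x = 1) \<and> j < n}"

definition ladder :: "nat \<Rightarrow> (int \<Rightarrow> int) \<Rightarrow> edge set" where
  "ladder n d = rails n \<union> (\<lambda>k. rung k (d k)) ` {0..2 * int n}"

text \<open>The condition for both ends of the rung to be lattice points of the strip.\<close>

definition rung_fits :: "nat \<Rightarrow> int \<Rightarrow> int \<Rightarrow> bool" where
  "rung_fits n k d \<longleftrightarrow> even (k - d) \<and> \<bar>d\<bar> \<le> k \<and> \<bar>d\<bar> \<le> 2 * int n - k"

lemma rung_eq_iff [simp]: "rung k d = rung k' d' \<longleftrightarrow> k = k' \<and> d = d'"
proof -
  have "rung k d = rung k' d' \<longleftrightarrow> real_of_int (k - d) = of_int (k' - d') \<and> real_of_int (k + d) = of_int (k' + d')"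
    unfolding rung_def doubleton_eq_iff by auto
  then show ?thesis unfolding of_int_eq_iff by linarith
qed

lemma rung_notin_rails: "rung k d \<notin> rails n"
  by (auto simp: rung_def rails_def doubleton_eq_iff)

lemma rung_shift:
  "rung k (h + 2 * s) = {(0, of_int (k - h) / 2 - of_int s), (1, of_int (k + h) / 2 + of_int s)}"
  by (simp add: rung_def add_divide_distrib diff_divide_distrib algebra_simps)

lemma edge_midpoint_rung: "edge_midpoint (rung k d) = (1 / 2, of_int k / 2)"
  by (simp add: rung_def midpoint_def field_simps)

lemma edge_length_rung: "edge_length (rung k d) = 1 + \<bar>of_int d\<bar>"
proof -
  have "of_int (k - d) / 2 - of_int (k + d) / 2 = - (of_int d :: real)" by (simp add: field_simps)
  then show ?thesis by (simp only: rung_def edge_length_doubleton fst_conv snd_conv abs_minus_cancel diff_0 diff_0_right abs_one)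
qed

lemma in_hull_rung_iff:
  "z \<in> convex hull (rung k d) \<longleftrightarrow> 0 \<le> fst z \<and> fst z \<le> 1 \<and> 2 * snd z = of_int k + of_int d * (2 * fst z - 1)"
proof -
  have "z \<in> convex hull (rung k d) \<longleftrightarrow> (\<exists>u. 0 \<le> u \<and> u \<le> 1 \<and> fst z = u
      \<and> snd z = (1 - u) * (of_int (k - d) / 2) + u * (of_int (k + d) / 2))"
    unfolding rung_def segment_convex_hull[symmetric] in_segment by (auto simp: prod_eq_iff)
  then show ?thesis by (auto simp: field_simps)
qed

lemma rung_end:
  assumes "z \<in> convex hull (rung k d)" "fst z = 0 \<or> fst z = 1"
  shows "z \<in> rung k d"
  using assms(2)
proof
  assume "fst z = 0"
  then have "z = (0, of_int (k - d) / 2)" using assms(1) by (simp add: in_hull_rung_iff prod_eq_iff)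
  then show ?thesis by (simp add: rung_def)
next
  assume "fst z = 1"
  then have "z = (1, of_int (k + d) / 2)" using assms(1) by (simp add: in_hull_rung_iff prod_eq_iff)
  then show ?thesis by (simp add: rung_def)
qed

lemma in_hull_rail_iff:
  "z \<in> convex hull {(x, y), (x, y + 1)} \<longleftrightarrow> fst z = x \<and> y \<le> snd z \<and> snd z \<le> y + 1" for x y :: real
proof -
  have "z \<in> convex hull {(x, y), (x, y + 1)} \<longleftrightarrow>
      (\<exists>u. 0 \<le> u \<and> u \<le> 1 \<and> fst z = x \<and> snd z = y + u)"
    unfolding segment_convex_hull[symmetric] in_segment by (auto simp: prod_eq_iff algebra_simps)
  also have "\<dots> \<longleftrightarrow> fst z = x \<and> y \<le> snd z \<and> snd z \<le> y + 1"
  proof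
    assume "fst z = x \<and> y \<le> snd z \<and> snd z \<le> y + 1"
    then show "\<exists>u. 0 \<le> u \<and> u \<le> 1 \<and> fst z = x \<and> snd z = y + u"
      by (intro exI[of _ "snd z - y"]) auto
  qed auto
  finally show ?thesis .
qed

lemma rung_in_edges:
  assumes "rung_fits n k d" shows "rung k d \<in> edges 1 n"
proof -
  obtain i where i: "k - d = 2 * i" using assms unfolding rung_fits_def by (elim conjE evenE)
  then have j: "k + d = 2 * (i + d)" by simp
  have b: "0 \<le> i" "i \<le> int n" "0 \<le> i + d" "i + d \<le> int n"
    using assms i by (auto simp: rung_fits_def)
  let ?p = "(0 :: real, real_of_int i)" and ?q = "(1 :: real, real_of_int (i + d))"
  have r: "rung k d = {?p, ?q}" unfolding rung_def i j of_int_mult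
    by (simp del: of_int_add)
  have "?p = (real 0, real (nat i))" "?q = (real 1, real (nat (i + d)))" using b by auto
  moreover have "nat i \<le> n" "nat (i + d) \<le> n" using b by auto
  ultimately have g: "?p \<in> grid 1 n" "?q \<in> grid 1 n" unfolding grid_def by blast+
  have "closed_segment ?p ?q \<inter> (\<int> \<times> \<int>) = {?p, ?q}"
  proof (intro equalityI subsetI)
    fix z assume z: "z \<in> closed_segment ?p ?q \<inter> (\<int> \<times> \<int>)"
    then have h: "z \<in> convex hull (rung k d)" by (simp add: r segment_convex_hull)
    from z have "fst z \<in> \<int>" by auto
    then obtain m where m: "fst z = of_int m" by (auto elim: Ints_cases)
    then have "0 \<le> m" "m \<le> 1" using h unfolding in_hull_rung_iff by auto
    then have "m = 0 \<or> m = 1" by linarith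
    then have "fst z = 0 \<or> fst z = 1" using m by auto
    then show "z \<in> {?p, ?q}" using rung_end[OF h] by (simp add: r)
  qed auto
  then show ?thesis unfolding r edges_def using g by (intro CollectI exI[of _ ?p] exI[of _ ?q]) auto
qed

lemma rail_in_edges:
  assumes "e \<in> rails n" shows "e \<in> edges 1 n"
proof -
  obtain x j where e: "e = {(x, real j), (x, real j + 1)}" and x: "x = 0 \<or> x = 1" and j: "j < n"
    using assms by (auto simp: rails_def)
  let ?p = "(x, real j)" and ?q = "(x, real j + 1)"
  have "?p = (real (if x = 0 then 0 else 1), real j)"
    "?q = (real (if x = 0 then 0 else 1), real (Suc j))" using x by auto
  moreover have "(if x = 0 then 0 else 1) \<le> (1::nat)" "j \<le> n" "Suc j \<le> n" using j by auto
  ultimately have g: "?p \<in> grid 1 n" "?q \<in> grid 1 n" unfolding grid_def by blast+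
  have "closed_segment ?p ?q \<inter> (\<int> \<times> \<int>) = {?p, ?q}"
  proof (intro equalityI subsetI)
    fix z assume z: "z \<in> closed_segment ?p ?q \<inter> (\<int> \<times> \<int>)"
    then have h: "fst z = x" "real j \<le> snd z" "snd z \<le> real j + 1"
      unfolding segment_convex_hull Int_iff in_hull_rail_iff by auto
    from z have "snd z \<in> \<int>" by auto
    then obtain m where m: "snd z = of_int m" by (auto elim: Ints_cases)
    have "m = int j \<or> m = int j + 1" using h m by linarith
    then show "z \<in> {?p, ?q}" using h m by (cases z) auto
  next
    fix z assume "z \<in> {?p, ?q}" then show "z \<in> closed_segment ?p ?q \<inter> (\<int> \<times> \<int>)" using x by auto
  qed
  then show ?thesis unfolding e edges_def using g by (intro CollectI exI[of _ ?p] exI[of _ ?q]) auto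
qed

lemma edges_1: "edges 1 n = rails n \<union> {rung k d |k d. rung_fits n k d}"
proof (intro equalityI subsetI)
  fix e assume "e \<in> edges 1 n"
  then obtain i j i' j' where e: "e = {(real i, real j), (real i', real j')}"
    and b: "i \<le> 1" "i' \<le> 1" "j \<le> n" "j' \<le> n"
    and ne: "(real i, real j) \<noteq> (real i', real j')"
    and seg: "closed_segment (real i, real j) (real i', real j') \<inter> (\<int> \<times> \<int>) = {(real i, real j), (real i', real j')}"
    by (auto simp: edges_def grid_def)
  have rail: "{(real i, real a), (real i, real b)} \<in> rails n"
    if ab: "a < b" "b \<le> n" and s: "closed_segment (real i, real a) (real i, real b) \<inter> (\<int> \<times> \<int>)
      = {(real i, real a), (real i, real b)}" for a b
  proof -
    define u where "u = 1 / (real b - real a)"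
    have u: "0 \<le> u" "u \<le> 1" "u * (real b - real a) = 1" using ab by (auto simp: u_def divide_simps)
    then have "(real i, real a + 1) = (1 - u) *\<^sub>R (real i, real a) + u *\<^sub>R (real i, real b)"
      by (simp add: algebra_simps)
    then have "(real i, real a + 1) \<in> closed_segment (real i, real a) (real i, real b)"
      unfolding in_segment using u by blast
    then have "(real i, real a + 1) \<in> {(real i, real a), (real i, real b)}"
      unfolding s[symmetric] by auto
    then have b: "real b = real a + 1" by auto
    have "real i = 0 \<or> real i = 1" using \<open>i \<le> 1\<close> by auto
    moreover have "a < n" using ab by simp
    ultimately show ?thesis unfolding b rails_def by blast
  qed
  have rung: "{(0, real a), (1, real b)} \<in> {rung k d |k d. rung_fits n k d}"
    if "a \<le> n" "b \<le> n" for a b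
  proof -
    have "{(0, real a), (1, real b)} = rung (int a + int b) (int b - int a)" by (simp add: rung_def)
    moreover have "rung_fits n (int a + int b) (int b - int a)" using that by (auto simp: rung_fits_def)
    ultimately show ?thesis by blast
  qed
  consider "i = i'" "j < j'" | "i = i'" "j' < j" | "i = 0" "i' = 1" | "i = 1" "i' = 0"
    using b ne by force
  then show "e \<in> rails n \<union> {rung k d |k d. rung_fits n k d}"
  proof cases
    case 1 then show ?thesis using rail[of j j'] b seg e by auto
  next
    case 2 then show ?thesis using rail[of j' j] b seg e by (auto simp: closed_segment_commute insert_commute)
  next
    case 3 then show ?thesis using rung[of j j'] b e by auto
  next
    case 4 then show ?thesis using rung[of j' j] b e by (auto simp: insert_commute)
  qed
qed (use rung_in_edges rail_in_edges in blast)

lemma crosses_sym: "crosses e f \<longleftrightarrow> crosses f e"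
  by (auto simp: crosses_def)

text \<open>Reduces noncrossing to integrality: two edges do not cross if they meet in lattice points only.\<close>

lemma lattice_point_on_edge:
  assumes "e \<in> edges m n" "z \<in> convex hull e" "fst z \<in> \<int>" "snd z \<in> \<int>"
  shows "z \<in> e"
proof -
  obtain p q where "e = {p, q}" "closed_segment p q \<inter> (\<int> \<times> \<int>) = {p, q}"
    using assms(1) by (auto simp: edges_def)
  moreover have "z \<in> \<int> \<times> \<int>" using assms(3,4) by (simp add: mem_Times_iff)
  ultimately show ?thesis using assms(2) by (auto simp: segment_convex_hull)
qed

text \<open>With \<open>s = 2 x - 1\<close> running through \<open>[-1, 1]\<close>, the rung lies at height \<open>(k + d s) / 2\<close>. Two rungs meet
  where \<open>k' - k = (d - d') s\<close>, which has a solution inside the strip exactly in the stated case; a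
  solution with \<open>s = \<plusminus>1\<close> is a common endpoint. Sets of noncrossing rungs are therefore graphs of
  1-Lipschitz functions.\<close>

lemma crosses_rung_iff: "crosses (rung k d) (rung k' d') \<longleftrightarrow> \<bar>k' - k\<bar> < \<bar>d' - d\<bar>"
proof
  assume cr: "crosses (rung k d) (rung k' d')"
  show "\<bar>k' - k\<bar> < \<bar>d' - d\<bar>"
  proof (rule ccontr)
    assume n: "\<not> \<bar>k' - k\<bar> < \<bar>d' - d\<bar>"
    obtain z where z: "z \<in> convex hull (rung k d)" "z \<in> convex hull (rung k' d')"
      "z \<notin> rung k d \<or> z \<notin> rung k' d'" "k \<noteq> k' \<or> d \<noteq> d'"
      using cr by (auto simp: crosses_def)
    define s where "s = 2 * fst z - 1"
    have s: "\<bar>s\<bar> \<le> 1" using z(1) by (auto simp: in_hull_rung_iff s_def)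
    have eq: "of_int (k' - k) = of_int (d - d') * s"
      using z(1,2) by (simp add: in_hull_rung_iff s_def algebra_simps)
    have kk: "k' \<noteq> k" using n z(4) by auto
    have "real_of_int \<bar>k' - k\<bar> = of_int \<bar>d' - d\<bar> * \<bar>s\<bar>"
      using eq by (metis abs_minus_commute abs_mult of_int_abs)
    moreover have "real_of_int \<bar>d' - d\<bar> * \<bar>s\<bar> \<le> of_int \<bar>k' - k\<bar> * \<bar>s\<bar>"
      using n by (intro mult_right_mono) auto
    ultimately have "real_of_int \<bar>k' - k\<bar> * 1 \<le> of_int \<bar>k' - k\<bar> * \<bar>s\<bar>" by simp
    moreover have "0 < real_of_int \<bar>k' - k\<bar>" using kk by simp
    ultimately have "1 \<le> \<bar>s\<bar>" by (simp only: mult_le_cancel_left_pos)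
    then have "s = 1 \<or> s = - 1" using s by linarith
    then have "fst z = 0 \<or> fst z = 1" by (auto simp: s_def)
    then have "z \<in> rung k d" "z \<in> rung k' d'"
      using rung_end[OF z(1)] rung_end[OF z(2)] by blast+
    then show False using z(3) by blast
  qed
next
  assume lt: "\<bar>k' - k\<bar> < \<bar>d' - d\<bar>"
  define s where "s = real_of_int (k' - k) / of_int (d - d')"
  have dd: "real_of_int (d - d') \<noteq> 0" using lt by auto
  have "real_of_int \<bar>k' - k\<bar> < of_int \<bar>d - d'\<bar>" using lt by linarith
  then have s: "\<bar>s\<bar> < 1" using dd by (simp add: s_def abs_divide divide_simps)
  have eq: "of_int (d - d') * s = of_int (k' - k)" using dd by (simp add: s_def)
  define z where "z = ((s + 1) / 2, (of_int k + of_int d * s) / 2)"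
  have z: "2 * fst z - 1 = s" "0 \<le> fst z" "fst z \<le> 1" "2 * snd z = of_int k + of_int d * s"
    using s by (auto simp: z_def add_divide_distrib)
  have z1: "z \<in> convex hull (rung k d)" unfolding in_hull_rung_iff z(1) using z by simp
  have z2: "z \<in> convex hull (rung k' d')" unfolding in_hull_rung_iff z(1)
    using z eq by (simp add: algebra_simps)
  have z3: "z \<notin> rung k d" using s by (auto simp: rung_def z_def)
  show "crosses (rung k d) (rung k' d')"
    unfolding crosses_def using lt z1 z2 z3 by (intro conjI exI[of _ z]) auto
qed

lemma rail_not_crosses:
  assumes e: "e \<in> rails n" and f: "f \<in> edges 1 n"
  shows "\<not> crosses e f"
proof
  assume "crosses e f"
  then obtain z where z: "e \<noteq> f" "z \<in> convex hull e" "z \<in> convex hull f" "z \<notin> e \<or> z \<notin> f"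
    by (auto simp: crosses_def)
  obtain x j where ex: "e = {(x, real j), (x, real j + 1)}" and x: "x = 0 \<or> x = 1"
    using e by (auto simp: rails_def)
  have ze: "fst z = x" "real j \<le> snd z" "snd z \<le> real j + 1"
    using z(2) unfolding ex in_hull_rail_iff by auto
  have "snd z \<in> \<int>"
  proof -
    consider y i where "f = {(y, real i), (y, real i + 1)}" | k d where "f = rung k d" "rung_fits n k d"
      using f unfolding edges_1 by (auto simp: rails_def)
    then show ?thesis
    proof cases
      case 1
      have zf: "fst z = y" "real i \<le> snd z" "snd z \<le> real i + 1"
        using z(3) unfolding 1 in_hull_rail_iff by auto
      have "i \<noteq> j" using zf(1) ze(1) z(1) 1 ex by auto
      then have "snd z = real i \<or> snd z = real j" using zf ze by linarith
      then show ?thesis by auto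
    next
      case 2
      obtain i where i: "k - d = 2 * i" using 2(2) unfolding rung_fits_def by (elim conjE evenE)
      have "2 * snd z = of_int (k - d) \<or> 2 * snd z = of_int (k - d) + 2 * of_int d"
        using z(3) ze(1) x unfolding 2(1) in_hull_rung_iff by auto
      then have "snd z = of_int i \<or> snd z = of_int (i + d)" unfolding i by auto
      then show ?thesis by (elim disjE) simp_all
    qed
  qed
  moreover have "fst z \<in> \<int>" using ze(1) x by auto
  ultimately have "z \<in> e" "z \<in> f"
    using lattice_point_on_edge[OF rail_in_edges[OF e] z(2)] lattice_point_on_edge[OF f z(3)] by auto
  then show False using z(4) by blast
qed

lemma bridge_rung_fits:
  assumes "bridge (2 * int n) d" "0 \<le> k" "k \<le> 2 * int n"
  shows "rung_fits n k (d k)"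
  using bridge_parity[OF assms] bridge_abs_le[OF assms(1,2)] bridge_abs_le'[OF assms(1,3)]
  by (simp add: rung_fits_def)

lemma ladder_subset_edges: "bridge (2 * int n) d \<Longrightarrow> ladder n d \<subseteq> edges 1 n"
  unfolding edges_1 using bridge_rung_fits by (auto simp: ladder_def)

lemma noncrossing_ladder:
  assumes b: "bridge (2 * int n) d"
  shows "noncrossing (ladder n d)"
  unfolding noncrossing_def
proof (intro ballI)
  fix e f assume ef: "e \<in> ladder n d" "f \<in> ladder n d"
  then have E: "e \<in> edges 1 n" "f \<in> edges 1 n" using ladder_subset_edges[OF b] by auto
  show "\<not> crosses e f"
  proof (cases "e \<in> rails n \<or> f \<in> rails n")
    case True then show ?thesis using rail_not_crosses E crosses_sym by blast
  next
    case False
    then obtain k k' where "e = rung k (d k)" "f = rung k' (d k')" using ef by (auto simp: ladder_def)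
    then show ?thesis using bridge_lipschitz[OF b, of k' k] by (simp add: crosses_rung_iff)
  qed
qed

text \<open>Maximality: every rung outside the ladder crosses the rung of the ladder with the same midpoint.\<close>

lemma triangulation_ladder:
  assumes b: "bridge (2 * int n) d"
  shows "triangulation 1 n (ladder n d)"
  unfolding triangulation_def
proof (intro conjI allI impI)
  fix \<tau> assume \<tau>: "ladder n d \<subseteq> \<tau> \<and> \<tau> \<subseteq> edges 1 n \<and> noncrossing \<tau>"
  have "e \<in> ladder n d" if e: "e \<in> \<tau>" for e
  proof (cases "e \<in> rails n")
    case False
    then obtain k h where kh: "e = rung k h" "rung_fits n k h"
      using e \<tau> unfolding edges_1 by blast
    then have k: "k \<in> {0..2 * int n}" by (auto simp: rung_fits_def)
    then have "rung k (d k) \<in> \<tau>" using \<tau> by (auto simp: ladder_def)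
    then have "\<not> crosses (rung k h) (rung k (d k))" using e kh \<tau> by (auto simp: noncrossing_def)
    then have "h = d k" by (simp add: crosses_rung_iff)
    then show ?thesis using kh k by (auto simp: ladder_def)
  qed (simp add: ladder_def)
  then show "\<tau> = ladder n d" using \<tau> by blast
qed (rule ladder_subset_edges[OF b], rule noncrossing_ladder[OF b])

text \<open>The rungs of a triangulation form the graph of a 1-Lipschitz function on a set of sites. McShane's
  extension formula gives a 1-Lipschitz function \<open>D\<close> at all sites, with the right parity; its rungs
  cross nothing, so maximality puts them into the triangulation. The rungs at both ends, being
  compatible with every edge, keep the extension within the strip.\<close>

lemma triangulation_is_ladder:
  assumes t: "triangulation 1 n \<sigma>"
  obtains d where "bridge (2 * int n) d" "\<sigma> = ladder n d"
proof -
  let ?N = "2 * int n"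
  have \<sigma>: "\<sigma> \<subseteq> edges 1 n" "noncrossing \<sigma>" using t by (auto simp: triangulation_def)
  have compat: "e \<in> \<sigma>" if e: "e \<in> edges 1 n" "\<And>f. f \<in> \<sigma> \<Longrightarrow> \<not> crosses e f" for e
  proof -
    have "noncrossing (insert e \<sigma>)"
      using e \<sigma>(2) crosses_sym by (auto simp: noncrossing_def crosses_def)
    then have "insert e \<sigma> = \<sigma>" using t e(1) \<sigma>(1) unfolding triangulation_def by blast
    then show ?thesis by blast
  qed
  have rails: "rails n \<subseteq> \<sigma>"
  proof
    fix e assume e: "e \<in> rails n"
    show "e \<in> \<sigma>" by (rule compat[OF rail_in_edges[OF e]]) (use rail_not_crosses[OF e] \<sigma>(1) in blast)
  qed
  define S where "S = {(k, h). rung_fits n k h \<and> rung k h \<in> \<sigma>}"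
  have S_lip: "\<bar>h' - h\<bar> \<le> \<bar>k' - k\<bar>" if "(k, h) \<in> S" "(k', h') \<in> S" for k h k' h'
  proof -
    have "\<not> crosses (rung k h) (rung k' h')" using that \<sigma>(2) by (auto simp: S_def noncrossing_def)
    then show ?thesis by (simp add: crosses_rung_iff)
  qed
  have S_ins: "(k, h) \<in> S" if "rung_fits n k h" "\<And>k' h'. (k', h') \<in> S \<Longrightarrow> \<bar>h' - h\<bar> \<le> \<bar>k' - k\<bar>" for k h
  proof -
    have "\<not> crosses (rung k h) f" if f: "f \<in> \<sigma>" for f
    proof -
      consider "f \<in> rails n" | k' h' where "f = rung k' h'" "rung_fits n k' h'"
        using f \<sigma>(1) unfolding edges_1 by blast
      then show ?thesis
      proof cases
        case 1 then show ?thesis using rail_not_crosses crosses_sym rung_in_edges \<open>rung_fits n k h\<close> by blast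
      next
        case 2
        then have "(k', h') \<in> S" using f by (simp add: S_def)
        then show ?thesis using \<open>\<And>k' h'. (k', h') \<in> S \<Longrightarrow> \<bar>h' - h\<bar> \<le> \<bar>k' - k\<bar>\<close> 2
          by (force simp: crosses_rung_iff)
      qed
    qed
    then show ?thesis using compat[OF rung_in_edges] \<open>rung_fits n k h\<close> by (simp add: S_def)
  qed
  have S_bot: "(0, 0) \<in> S" by (rule S_ins) (auto simp: rung_fits_def S_def)
  have S_top: "(?N, 0) \<in> S" by (rule S_ins) (auto simp: rung_fits_def S_def)
  have finS: "finite S"
  proof (rule finite_subset)
    show "S \<subseteq> {0..?N} \<times> {- ?N..?N}" by (auto simp: S_def rung_fits_def)
  qed simp
  \<comment> \<open>McShane's extension of the partial function \<open>S\<close>.\<close>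
  define D where "D k = Max ((\<lambda>(k', h'). h' - \<bar>k - k'\<bar>) ` S)" for k
  have D_ge: "h' - \<bar>k - k'\<bar> \<le> D k" if "(k', h') \<in> S" for k k' h'
    unfolding D_def using finS that by (intro Max_ge) (auto simp: image_iff intro!: bexI[of _ "(k', h')"])
  have D_ex: "\<exists>k' h'. (k', h') \<in> S \<and> D k = h' - \<bar>k - k'\<bar>" for k
  proof -
    have "D k \<in> (\<lambda>(k', h'). h' - \<bar>k - k'\<bar>) ` S"
      unfolding D_def using finS S_bot by (intro Max_in) auto
    then show ?thesis by auto
  qed
  have D_le: "\<bar>h' - D k\<bar> \<le> \<bar>k' - k\<bar>" if "(k', h') \<in> S" for k k' h'
  proof -
    obtain k2 h2 where 2: "(k2, h2) \<in> S" "D k = h2 - \<bar>k - k2\<bar>" using D_ex by blast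
    show ?thesis using D_ge[OF that, of k] S_lip[OF that 2(1)] 2(2) by linarith
  qed
  have D_S: "(k, D k) \<in> S" if k: "k \<in> {0..?N}" for k
  proof (rule S_ins)
    obtain k2 h2 where 2: "(k2, h2) \<in> S" "D k = h2 - \<bar>k - k2\<bar>" using D_ex by blast
    have "even (k2 - h2)" using 2(1) by (auto simp: S_def rung_fits_def)
    moreover have "even (k - k2 + \<bar>k - k2\<bar>)" by presburger
    moreover have "k - D k = (k2 - h2) + (k - k2 + \<bar>k - k2\<bar>)" using 2(2) by simp
    ultimately have "even (k - D k)" by presburger
    then show "rung_fits n k (D k)"
      using D_le[OF S_bot, of k] D_le[OF S_top, of k] k by (simp add: rung_fits_def)
  qed (use D_le in auto)
  have D_unique: "h = D k" if "(k, h) \<in> S" for k h using D_le[OF that, of k] by simp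
  define d where "d k = (if k \<in> {0..?N} then D k else 0)" for k
  have fits: "rung_fits n k (D k)" if "k \<in> {0..?N}" for k using D_S[OF that] by (simp add: S_def)
  have "bridge ?N d"
    unfolding bridge_def
  proof (intro conjI allI impI ballI)
    fix k assume "k \<le> 0 \<or> ?N \<le> k"
    then show "d k = 0" using fits[of 0] fits[of ?N] by (auto simp: d_def rung_fits_def)
  next
    fix k assume k: "k \<in> {0..<?N}"
    then have "\<bar>D (k + 1) - D k\<bar> \<le> 1" using S_lip[OF D_S[of k] D_S[of "k + 1"]] by auto
    moreover have "even (k - D k)" "even (k + 1 - D (k + 1))"
      using fits[of k] fits[of "k + 1"] k by (auto simp: rung_fits_def)
    then have "D (k + 1) \<noteq> D k" by auto
    ultimately show "\<bar>d (k + 1) - d k\<bar> = 1" using k by (simp add: d_def)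
  qed
  moreover have "\<sigma> = ladder n d"
  proof (intro equalityI subsetI)
    fix e assume e: "e \<in> \<sigma>"
    show "e \<in> ladder n d"
    proof (cases "e \<in> rails n")
      case False
      then obtain k h where kh: "e = rung k h" "rung_fits n k h" using e \<sigma>(1) unfolding edges_1 by blast
      then have "h = D k" using e D_unique[of k h] by (simp add: S_def)
      moreover have "k \<in> {0..?N}" using kh(2) by (auto simp: rung_fits_def)
      ultimately show ?thesis using kh(1) by (auto simp: ladder_def d_def)
    qed (simp add: ladder_def)
  next
    fix e assume "e \<in> ladder n d"
    then show "e \<in> \<sigma>" using rails D_S by (auto simp: ladder_def d_def S_def)
  qed
  ultimately show thesis using that by blast
qed


section \<open>Flips of triangulations as flips of bridges\<close>

lemma hull_subset_halfspace_le:
  "S \<subseteq> {z. a \<bullet> z \<le> b} \<Longrightarrow> convex hull S \<subseteq> {z. a \<bullet> z \<le> b}"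
  by (intro hull_minimal convex_halfspace_le)

lemma interior_hull_halfspace:
  fixes a :: "'a::euclidean_space"
  assumes "a \<noteq> 0" "S \<subseteq> {z. a \<bullet> z \<le> b}" "z \<in> interior (convex hull S)"
  shows "a \<bullet> z < b"
  using interior_mono[OF hull_subset_halfspace_le[OF assms(2)]] assms(1,3) by auto

text \<open>The interior of the triangle lies strictly between two consecutive rungs, whereas each rung lies
  weakly below the lower or weakly above the upper one by the Lipschitz property, and rails lie on
  the boundary of the strip.\<close>

lemma ladder_face_interior:
  assumes b: "bridge (2 * int n) d" and k: "0 \<le> k" "k < 2 * int n" and e: "e \<in> ladder n d"
  shows "convex hull e \<inter> interior (convex hull (rung k (d k) \<union> rung (k + 1) (d (k + 1)))) = {}"
proof -
  let ?T = "rung k (d k) \<union> rung (k + 1) (d (k + 1))"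
  have step: "\<bar>d (k + 1) - d k\<bar> = 1" using b k by (simp add: bridge_def)
  have side: "\<bar>of_int (h - h') * (2 * fst z - 1)\<bar> \<le> real_of_int \<bar>h - h'\<bar>"
    if "z \<in> convex hull rung j h" for z j h h'
  proof -
    have "\<bar>2 * fst z - 1\<bar> \<le> 1" using that by (auto simp: in_hull_rung_iff)
    then show ?thesis by (simp add: abs_mult mult_left_le)
  qed
  have False if z: "z \<in> convex hull e" "z \<in> interior (convex hull ?T)" for z
  proof -
    define c where "c i = (- 2 * real_of_int (d i), 2 :: real)" for i
    define v where "v i = real_of_int (i - d i)" for i
    have c: "c i \<noteq> 0" for i by (simp add: c_def zero_prod_def)
    have inner: "c i \<bullet> p = 2 * snd p - 2 * of_int (d i) * fst p" for i and p :: point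
      by (simp add: c_def inner_prod_def)
    have in_rung: "c i \<bullet> p - v i = of_int (j - i) + of_int (d j - d i) * (2 * fst p - 1)"
      if "p \<in> convex hull rung j (d j)" for i j p
      using that by (simp add: inner v_def in_hull_rung_iff algebra_simps)
    have lip: "\<bar>of_int (d j - d i) * (2 * fst p - 1)\<bar> \<le> real_of_int \<bar>j - i\<bar>"
      if "p \<in> convex hull rung j (d j)" for i j p
    proof -
      have "real_of_int \<bar>d j - d i\<bar> \<le> of_int \<bar>j - i\<bar>"
        using bridge_lipschitz[OF b, of j i] by (simp only: of_int_le_iff)
      then show ?thesis using side[OF that, of "d i"] by linarith
    qed
    have above: "v i \<le> c i \<bullet> p" if "p \<in> convex hull rung j (d j)" "i \<le> j" for i j p
      using in_rung[OF that(1), of i] lip[OF that(1), of i] that(2) by simp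
    have below: "c i \<bullet> p \<le> v i" if "p \<in> convex hull rung j (d j)" "j \<le> i" for i j p
      using in_rung[OF that(1), of i] lip[OF that(1), of i] that(2) by simp
    have x: "0 < fst z" "fst z < 1"
    proof -
      have "?T \<subseteq> {p. (- 1 :: real, 0 :: real) \<bullet> p \<le> 0}" "?T \<subseteq> {p. (1 :: real, 0 :: real) \<bullet> p \<le> 1}"
        by (auto simp: rung_def)
      from interior_hull_halfspace[OF _ this(1) z(2)] interior_hull_halfspace[OF _ this(2) z(2)]
      have "(- 1, 0) \<bullet> z < 0" "(1, 0) \<bullet> z < 1" by (simp_all add: zero_prod_def)
      then show "0 < fst z" "fst z < 1" by (auto simp: inner_prod_def)
    qed
    have lo: "v k < c k \<bullet> z"
    proof -
      have "?T \<subseteq> {p. (- c k) \<bullet> p \<le> - v k}"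
        using above[OF hull_inc, of _ k k] above[OF hull_inc, of _ "k + 1" k] by auto
      from interior_hull_halfspace[OF _ this z(2)] show ?thesis using c by simp
    qed
    have hi: "c (k + 1) \<bullet> z < v (k + 1)"
    proof -
      have "?T \<subseteq> {p. c (k + 1) \<bullet> p \<le> v (k + 1)}"
        using below[OF hull_inc, of _ k "k + 1"] below[OF hull_inc, of _ "k + 1" "k + 1"] by auto
      from interior_hull_halfspace[OF _ this z(2)] show ?thesis using c by simp
    qed
    show False
    proof (cases "e \<in> rails n")
      case True
      then obtain x y where "e = {(x, y), (x, y + 1)}" "x = 0 \<or> x = (1::real)" by (auto simp: rails_def)
      then show False using z(1) x by (auto simp: in_hull_rail_iff)
    next
      case False
      then obtain j where j: "e = rung j (d j)" using e by (auto simp: ladder_def)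
      show False
      proof (cases "j \<le> k")
        case True then show False using below[of z j k] z(1) lo j by simp
      next
        case False then show False using above[of z j "k + 1"] z(1) hi j by simp
      qed
    qed
  qed
  then show ?thesis by blast
qed

text \<open>The union of the two triangles is the hull of all four points: in a convex combination the
  smaller of the coefficients of \<open>c\<close> and \<open>d\<close> can be moved to \<open>a\<close> and \<open>b\<close>, since \<open>c + d = a + b\<close>. Each
  vertex is extreme since writing it by the others would give a linear relation between \<open>b - a\<close>
  and \<open>c - a\<close>.\<close>

lemma parallelogram_convex_quadrilateral:
  assumes nc: "\<not> collinear {a, b, c}" and d: "c + d = a + b"
  shows "form_convex_quadrilateral a b c d"
proof -
  have indep: "s = 0 \<and> t = 0" if st: "s *\<^sub>R (b - a) + t *\<^sub>R (c - a) = 0" for s t :: real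
  proof (rule ccontr)
    assume ne: "\<not> (s = 0 \<and> t = 0)"
    have col: "collinear {b, a, c}"
    proof (cases "s = 0")
      case True
      then have "a = c" using st ne by auto
      then show ?thesis by simp
    next
      case False
      have "s *\<^sub>R (b - a) = - t *\<^sub>R (c - a)" using st by (simp add: eq_neg_iff_add_eq_0)
      then have "b - a = (- t / s) *\<^sub>R (c - a)" using False
        by (metis divideR_right scaleR_scaleR divide_inverse mult.commute real_scaleR_def scaleR_left_commute scaleR_one left_inverse)
      then have "b = (- t / s) *\<^sub>R c + (1 - (- t / s)) *\<^sub>R a" by (simp add: algebra_simps)
      then have "collinear {c, b, a}" unfolding collinear_3_expand by blast
      then show ?thesis by (simp add: insert_commute)
    qed
    then show False using nc by (simp add: insert_commute)
  qed
  have d': "d = a + b - c" using d by (simp add: algebra_simps)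
  have hull4: "\<exists>x u v w. 0 \<le> x \<and> 0 \<le> u \<and> 0 \<le> v \<and> 0 \<le> w \<and> x + u + v + w = 1 \<and> z = x *\<^sub>R a + u *\<^sub>R b + v *\<^sub>R c + w *\<^sub>R d"
    if z: "z \<in> convex hull {a, b, c, d}" for z
  proof -
    obtain x y q where x: "0 \<le> x" "0 \<le> y" "x + y = 1" "q \<in> convex hull {b, c, d}" "z = x *\<^sub>R a + y *\<^sub>R q"
      using z by (auto simp: convex_hull_insert[of "{b, c, d}" a])
    obtain u v w where u: "0 \<le> u" "0 \<le> v" "0 \<le> w" "u + v + w = 1" "q = u *\<^sub>R b + v *\<^sub>R c + w *\<^sub>R d"
      using x(4) unfolding convex_hull_3 by blast
    have "z = x *\<^sub>R a + (y * u) *\<^sub>R b + (y * v) *\<^sub>R c + (y * w) *\<^sub>R d"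
      unfolding x(5) u(5) by (simp add: algebra_simps)
    moreover have "x + y * u + y * v + y * w = x + y * (u + v + w)" by (simp add: algebra_simps)
    then have "x + y * u + y * v + y * w = 1" using x(3) u(4) by simp
    moreover have "0 \<le> y * u" "0 \<le> y * v" "0 \<le> y * w" using x(2) u(1-3) by simp_all
    ultimately show ?thesis using x(1) by blast
  qed
  have union: "convex hull {a, b, c} \<union> convex hull {a, b, d} = convex hull {a, b, c, d}"
  proof (intro equalityI subsetI)
    fix z assume "z \<in> convex hull {a, b, c, d}"
    then obtain x u v w where h: "0 \<le> x" "0 \<le> u" "0 \<le> v" "0 \<le> w" "x + u + v + w = 1"
      and z: "z = x *\<^sub>R a + u *\<^sub>R b + v *\<^sub>R c + w *\<^sub>R d" using hull4 by blast
    show "z \<in> convex hull {a, b, c} \<union> convex hull {a, b, d}"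
    proof (cases "w \<le> v")
      case True
      have "z = (x + w) *\<^sub>R a + (u + w) *\<^sub>R b + (v - w) *\<^sub>R c"
        unfolding z d' by (simp add: algebra_simps)
      moreover have "(x + w) + (u + w) + (v - w) = 1" using h by simp
      ultimately show ?thesis unfolding convex_hull_3 using h True
        by (intro UnI1 CollectI exI[of _ "x + w"] exI[of _ "u + w"] exI[of _ "v - w"]) auto
    next
      case False
      have "z = (x + v) *\<^sub>R a + (u + v) *\<^sub>R b + (w - v) *\<^sub>R d"
        unfolding z d' by (simp add: algebra_simps)
      moreover have "(x + v) + (u + v) + (w - v) = 1" using h by simp
      ultimately show ?thesis unfolding convex_hull_3 using h False
        by (intro UnI2 CollectI exI[of _ "x + v"] exI[of _ "u + v"] exI[of _ "w - v"]) auto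
    qed
  next
    fix z assume "z \<in> convex hull {a, b, c} \<union> convex hull {a, b, d}"
    moreover have "convex hull {a, b, c} \<subseteq> convex hull {a, b, c, d}" "convex hull {a, b, d} \<subseteq> convex hull {a, b, c, d}"
      by (intro hull_mono; auto)+
    ultimately show "z \<in> convex hull {a, b, c, d}" by blast
  qed
  have outside: "p \<notin> convex hull {q, r, t}"
    if "\<And>u v w. 0 \<le> u \<Longrightarrow> 0 \<le> v \<Longrightarrow> 0 \<le> w \<Longrightarrow> u + v + w = 1 \<Longrightarrow> p \<noteq> u *\<^sub>R q + v *\<^sub>R r + w *\<^sub>R t"
    for p q r t
    using that unfolding convex_hull_3 by blast
  have "a \<notin> convex hull {b, c, d}"
  proof (rule outside, rule notI)
    fix u v w :: real assume h: "0 \<le> u" "0 \<le> v" "0 \<le> w" "u + v + w = 1" "a = u *\<^sub>R b + v *\<^sub>R c + w *\<^sub>R d"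
    have u: "u = 1 - v - w" using h(4) by simp
    have "u *\<^sub>R b + v *\<^sub>R c + w *\<^sub>R d - a = (u + w) *\<^sub>R (b - a) + (v - w) *\<^sub>R (c - a)"
      unfolding d' u by (simp add: algebra_simps)
    then show False using indep[of "u + w" "v - w"] h by auto
  qed
  moreover have "b \<notin> convex hull {a, c, d}"
  proof (rule outside, rule notI)
    fix u v w :: real assume h: "0 \<le> u" "0 \<le> v" "0 \<le> w" "u + v + w = 1" "b = u *\<^sub>R a + v *\<^sub>R c + w *\<^sub>R d"
    have u: "u = 1 - v - w" using h(4) by simp
    have "u *\<^sub>R a + v *\<^sub>R c + w *\<^sub>R d - b = (w - 1) *\<^sub>R (b - a) + (v - w) *\<^sub>R (c - a)"
      unfolding d' u by (simp add: algebra_simps)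
    then show False using indep[of "w - 1" "v - w"] h by auto
  qed
  moreover have "c \<notin> convex hull {a, b, d}"
  proof (rule outside, rule notI)
    fix u v w :: real assume h: "0 \<le> u" "0 \<le> v" "0 \<le> w" "u + v + w = 1" "c = u *\<^sub>R a + v *\<^sub>R b + w *\<^sub>R d"
    have u: "u = 1 - v - w" using h(4) by simp
    have "u *\<^sub>R a + v *\<^sub>R b + w *\<^sub>R d - c = (v + w) *\<^sub>R (b - a) + (- w - 1) *\<^sub>R (c - a)"
      unfolding d' u by (simp add: algebra_simps)
    then show False using indep[of "v + w" "- w - 1"] h by auto
  qed
  moreover have "d \<notin> convex hull {a, b, c}"
  proof (rule outside, rule notI)
    fix u v w :: real assume h: "0 \<le> u" "0 \<le> v" "0 \<le> w" "u + v + w = 1" "d = u *\<^sub>R a + v *\<^sub>R b + w *\<^sub>R c"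
    have u: "u = 1 - v - w" using h(4) by simp
    have "u *\<^sub>R a + v *\<^sub>R b + w *\<^sub>R c - d = (v - 1) *\<^sub>R (b - a) + (w + 1) *\<^sub>R (c - a)"
      unfolding d' u by (simp add: algebra_simps)
    then show False using indep[of "v - 1" "w + 1"] h by auto
  qed
  ultimately have "\<forall>p\<in>{a, b, c, d}. p extreme_point_of (convex hull {a, b, c, d})"
    using extreme_point_of_convex_hull_insert[of "{b, c, d}" a] extreme_point_of_convex_hull_insert[of "{a, c, d}" b]
      extreme_point_of_convex_hull_insert[of "{a, b, d}" c] extreme_point_of_convex_hull_insert[of "{a, b, c}" d]
    by (simp add: insert_commute)
  then show ?thesis unfolding form_convex_quadrilateral_def union by (simp add: convex_convex_hull)
qed

lemma triangle_of_commute: "triangle_of \<sigma> a b c \<longleftrightarrow> triangle_of \<sigma> b a c"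
  "triangle_of \<sigma> a b c \<longleftrightarrow> triangle_of \<sigma> c b a"
  unfolding triangle_of_def by (auto simp: insert_commute)

lemma form_convex_quadrilateral_commute:
  "form_convex_quadrilateral a b c d \<longleftrightarrow> form_convex_quadrilateral b a c d"
  "form_convex_quadrilateral a b c d \<longleftrightarrow> form_convex_quadrilateral a b d c"
  unfolding form_convex_quadrilateral_def by (auto simp: insert_commute Un_commute)

text \<open>Rules out the noncorners: there, the two triangles at a rung have one of its ends as the
  midpoint of their two other vertices.\<close>

lemma form_convex_quadrilateral_midpoint:
  assumes q: "form_convex_quadrilateral a b c d" and "c \<noteq> d"
  shows "a \<noteq> midpoint c d" "b \<noteq> midpoint c d"
proof -
  let ?H = "convex hull {a, b, c, d}"
  have H: "c \<in> ?H" "d \<in> ?H" by (auto intro: hull_inc)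
  have "p \<noteq> midpoint c d" if "p extreme_point_of ?H" for p
    using that H assms(2) unfolding extreme_point_of_def by (metis midpoint_in_open_segment)
  then show "a \<noteq> midpoint c d" "b \<noteq> midpoint c d"
    using q by (auto simp: form_convex_quadrilateral_def)
qed

lemma collinear_vertical:
  fixes a b c :: point
  assumes "fst a = fst b" "fst b = fst c"
  shows "collinear {a, b, c}"
proof (cases "a = c")
  case False
  define u where "u = (snd b - snd c) / (snd a - snd c)"
  have "snd a - snd c \<noteq> 0" using False assms by (simp add: prod_eq_iff)
  then have "u * (snd a - snd c) = snd b - snd c" by (simp add: u_def)
  then have "b = u *\<^sub>R a + (1 - u) *\<^sub>R c" using assms by (simp add: prod_eq_iff algebra_simps)
  then show ?thesis unfolding collinear_3_expand by blast
next
  case True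
  then show ?thesis using collinear_2[of c b] by (simp add: insert_commute)
qed

lemma not_collinear_strip:
  fixes a b c :: point
  assumes "fst a = fst c" "snd a \<noteq> snd c" "fst b \<noteq> fst a"
  shows "\<not> collinear {a, b, c}"
proof
  assume "collinear {a, b, c}"
  then obtain u where "b = u *\<^sub>R a + (1 - u) *\<^sub>R c" using assms(2) unfolding collinear_3_expand by auto
  then have "fst b = u * fst a + (1 - u) * fst c" by simp
  then show False using assms by (simp add: algebra_simps)
qed


lemma triangle_of_ladder:
  assumes b: "bridge (2 * int n) d" and k: "0 \<le> k" "k < 2 * int n"
  shows "d (k + 1) = d k + 1 \<Longrightarrow>
      triangle_of (ladder n d) (0, of_int (k - d k) / 2) (1, of_int (k + d k) / 2) (1, of_int (k + d k) / 2 + 1)"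
    and "d (k + 1) = d k - 1 \<Longrightarrow>
      triangle_of (ladder n d) (0, of_int (k - d k) / 2) (1, of_int (k + d k) / 2) (0, of_int (k - d k) / 2 + 1)"
proof -
  let ?a = "(0 :: real, of_int (k - d k) / 2 :: real)" and ?b = "(1 :: real, of_int (k + d k) / 2 :: real)"
  obtain i where i: "k - d k = 2 * i"
    using evenE[OF bridge_parity[OF b, of k]] k by auto
  then have j: "k + d k = 2 * (i + d k)" by simp
  have half: "real_of_int (k - d k) / 2 = of_int i" "real_of_int (k + d k) / 2 = of_int (i + d k)"
    unfolding i j by simp_all
  have fits: "\<bar>d k\<bar> \<le> k" "\<bar>d (k + 1)\<bar> \<le> 2 * int n - (k + 1)"
    using bridge_rung_fits[OF b, of k] bridge_rung_fits[OF b, of "k + 1"] k by (auto simp: rung_fits_def)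
  have rungs: "rung k (d k) \<in> ladder n d" "rung (k + 1) (d (k + 1)) \<in> ladder n d"
    using k by (auto simp: ladder_def)
  have rail: "{(x, of_int m), (x, of_int m + 1)} \<in> ladder n d"
    if "x = 0 \<or> x = (1 :: real)" "0 \<le> m" "m < int n" for x m
  proof -
    have m: "of_int m = real (nat m)" "nat m < n" using that by auto
    show ?thesis unfolding ladder_def rails_def m(1) using m(2) that(1) by blast
  qed
  {
    assume up: "d (k + 1) = d k + 1"
    let ?c = "(1 :: real, of_int (k + d k) / 2 + 1 :: real)"
    have "k + 1 - d (k + 1) = k - d k" "k + 1 + d (k + 1) = k + d k + 2" using up by auto
    then have r1: "rung (k + 1) (d (k + 1)) = {?a, ?c}"
      by (simp only: rung_def) (simp add: add_divide_distrib)
    have T: "rung k (d k) \<union> rung (k + 1) (d (k + 1)) = {?a, ?b, ?c}"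
      unfolding r1 by (auto simp: rung_def)
    have "0 \<le> i + d k" "i + d k < int n" using fits i up by auto
    then have "{?b, ?c} \<in> ladder n d" unfolding half using rail[of 1 "i + d k"] by blast
    then show "triangle_of (ladder n d) ?a ?b ?c"
      unfolding triangle_of_def T[symmetric] using rungs ladder_face_interior[OF b k]
        not_collinear_strip[of ?b ?c ?a]
      unfolding r1 by (simp add: rung_def insert_commute)
  }
  {
    assume down: "d (k + 1) = d k - 1"
    let ?c = "(0 :: real, of_int (k - d k) / 2 + 1 :: real)"
    have "k + 1 - d (k + 1) = k - d k + 2" "k + 1 + d (k + 1) = k + d k" using down by auto
    then have r1: "rung (k + 1) (d (k + 1)) = {?b, ?c}"
      by (simp only: rung_def) (simp add: add_divide_distrib insert_commute)
    have T: "rung k (d k) \<union> rung (k + 1) (d (k + 1)) = {?a, ?b, ?c}"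
      unfolding r1 by (auto simp: rung_def)
    have "0 \<le> i" "i < int n" using fits i down by auto
    then have "{?a, ?c} \<in> ladder n d" unfolding half using rail[of 0 i] by blast
    then show "triangle_of (ladder n d) ?a ?b ?c"
      unfolding triangle_of_def T[symmetric] using rungs ladder_face_interior[OF b k]
        not_collinear_strip[of ?a ?c ?b]
      unfolding r1 by (simp add: rung_def insert_commute)
  }
qed

text \<open>Eliminates an edge of known endpoints by the side of the strip on which they lie.\<close>

lemma ladder_edge_cases:
  assumes "{p, q} \<in> ladder n d"
  obtains "fst p = fst q" "fst p = 0 \<or> fst p = 1" "snd q = snd p + 1 \<or> snd q = snd p - 1"
  | k where "0 \<le> k" "k \<le> 2 * int n" "fst p = 0" "fst q = 1"
      "snd p = of_int (k - d k) / 2" "snd q = of_int (k + d k) / 2"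
  | k where "0 \<le> k" "k \<le> 2 * int n" "fst p = 1" "fst q = 0"
      "snd q = of_int (k - d k) / 2" "snd p = of_int (k + d k) / 2"
proof -
  consider x y where "{p, q} = {(x, y), (x, y + 1)}" "x = 0 \<or> x = (1 :: real)"
    | k where "{p, q} = rung k (d k)" "0 \<le> k" "k \<le> 2 * int n"
    using assms by (auto simp: ladder_def rails_def)
  then show thesis
  proof cases
    case 1 then show thesis using that(1) by (auto simp: doubleton_eq_iff)
  next
    case 2 then show thesis using that(2,3)[of k] by (auto simp: doubleton_eq_iff rung_def)
  qed
qed

text \<open>A triangle at the rung \<open>k\<close> has one rail and one further rung, which must be the rung \<open>k + 1\<close> or
  \<open>k - 1\<close>; the step of the bridge there decides on which side the triangle has its third vertex.\<close>

lemma third_vertex: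
  assumes b: "bridge (2 * int n) d" and t: "triangle_of (ladder n d) a b c"
    and a: "a = (0, of_int (k - d k) / 2)" and bb: "b = (1, of_int (k + d k) / 2)"
  obtains s where "s = 1 \<or> s = - 1" "0 \<le> k + s" "k + s \<le> 2 * int n"
    "d (k + s) = d k - s \<and> c = (0, of_int (k - d k) / 2 + of_int s) \<or>
     d (k + s) = d k + s \<and> c = (1, of_int (k + d k) / 2 + of_int s)"
proof -
  have ac: "{a, c} \<in> ladder n d" and bc: "{b, c} \<in> ladder n d" using t by (auto simp: triangle_of_def)
  have split: "\<exists>s::int. (s = 1 \<or> s = - 1) \<and> y = x + of_int s" if "y = x + 1 \<or> y = x - 1" for x y :: real
    using that by (intro exI[of _ "if y = x + 1 then 1 else - 1"]) auto
  have fc: "fst c = 0 \<or> fst c = 1" using ac a by (elim ladder_edge_cases) auto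
  then show thesis
  proof
    assume c: "fst c = 0"
    have "snd c = snd a + 1 \<or> snd c = snd a - 1" using ac by (rule ladder_edge_cases) (auto simp: a c)
    then obtain s where s: "s = 1 \<or> s = - 1" "snd c = snd a + of_int s" using split by blast
    obtain j where j: "0 \<le> j" "j \<le> 2 * int n" "snd c = of_int (j - d j) / 2" "snd b = of_int (j + d j) / 2"
      using bc by (rule ladder_edge_cases) (auto simp: bb c)
    have "real_of_int (j - d j) = of_int (k - d k + 2 * s)" "real_of_int (j + d j) = of_int (k + d k)"
      using j(3,4) s(2) by (simp_all add: a bb field_simps)
    then have "j - d j = k - d k + 2 * s" "j + d j = k + d k" by (simp_all only: of_int_eq_iff)
    then have "j = k + s" "d j = d k - s" by auto
    then show thesis using that[OF s(1)] j(1,2) s(2) c by (auto simp: a prod_eq_iff)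
  next
    assume c: "fst c = 1"
    have "snd c = snd b + 1 \<or> snd c = snd b - 1" using bc by (rule ladder_edge_cases) (auto simp: bb c)
    then obtain s where s: "s = 1 \<or> s = - 1" "snd c = snd b + of_int s" using split by blast
    obtain j where j: "0 \<le> j" "j \<le> 2 * int n" "snd a = of_int (j - d j) / 2" "snd c = of_int (j + d j) / 2"
      using ac by (rule ladder_edge_cases) (auto simp: a c)
    have "real_of_int (j + d j) = of_int (k + d k + 2 * s)" "real_of_int (j - d j) = of_int (k - d k)"
      using j(3,4) s(2) by (simp_all add: a bb field_simps)
    then have "j + d j = k + d k + 2 * s" "j - d j = k - d k" by (simp_all only: of_int_eq_iff)
    then have "j = k + s" "d j = d k + s" by auto
    then show thesis using that[OF s(1)] j(1,2) s(2) c by (auto simp: bb prod_eq_iff)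
  qed
qed

text \<open>Only one triangle of the strip contains a given rail: with two apexes on the opposite side, the
  lower end of the rail joined to the upper apex would cross the upper end joined to the lower
  apex.\<close>

lemma rail_not_flippable:
  assumes b: "bridge (2 * int n) d" and t: "triangle_of (ladder n d) p q c" "triangle_of (ladder n d) p q c'"
    and pq: "fst p = fst q"
  shows "c = c'"
proof -
  have edge: "{p, q} \<in> ladder n d" using t(1) by (auto simp: triangle_of_def)
  have x: "fst p = 0 \<or> fst p = 1" and y: "snd q = snd p + 1 \<or> snd q = snd p - 1"
    using edge pq by (auto elim: ladder_edge_cases)
  have apex: "\<exists>j j'. snd r = of_int (if fst p = 0 then j + d j else j - d j) / 2
      \<and> snd p = of_int (if fst p = 0 then j - d j else j + d j) / 2
      \<and> snd r = of_int (if fst p = 0 then j' + d j' else j' - d j') / 2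
      \<and> snd q = of_int (if fst p = 0 then j' - d j' else j' + d j') / 2 \<and> fst r = 1 - fst p"
    if r: "triangle_of (ladder n d) p q r" for r
  proof -
    have e: "{p, r} \<in> ladder n d" "{q, r} \<in> ladder n d" and nc: "\<not> collinear {p, q, r}"
      using r by (auto simp: triangle_of_def)
    have ne: "fst r \<noteq> fst p" using nc collinear_vertical[of p q r] pq by auto
    obtain j where "fst r = 1 - fst p" "snd r = of_int (if fst p = 0 then j + d j else j - d j) / 2"
      "snd p = of_int (if fst p = 0 then j - d j else j + d j) / 2"
      using e(1) by (rule ladder_edge_cases) (use ne in auto)
    moreover obtain j' where "snd r = of_int (if fst p = 0 then j' + d j' else j' - d j') / 2"
      "snd q = of_int (if fst p = 0 then j' - d j' else j' + d j') / 2"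
      using e(2) by (rule ladder_edge_cases) (use ne pq in auto)
    ultimately show ?thesis by blast
  qed
  obtain j1 j1' where 1: "snd c = of_int (if fst p = 0 then j1 + d j1 else j1 - d j1) / 2"
    "snd p = of_int (if fst p = 0 then j1 - d j1 else j1 + d j1) / 2"
    "snd c = of_int (if fst p = 0 then j1' + d j1' else j1' - d j1') / 2"
    "snd q = of_int (if fst p = 0 then j1' - d j1' else j1' + d j1') / 2" "fst c = 1 - fst p"
    using apex[OF t(1)] by blast
  obtain j2 j2' where 2: "snd c' = of_int (if fst p = 0 then j2 + d j2 else j2 - d j2) / 2"
    "snd p = of_int (if fst p = 0 then j2 - d j2 else j2 + d j2) / 2"
    "snd c' = of_int (if fst p = 0 then j2' + d j2' else j2' - d j2') / 2"
    "snd q = of_int (if fst p = 0 then j2' - d j2' else j2' + d j2') / 2" "fst c' = 1 - fst p"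
    using apex[OF t(2)] by blast
  have L: "real_of_int \<bar>d j1' - d j2\<bar> \<le> of_int \<bar>j1' - j2\<bar>" "real_of_int \<bar>d j2' - d j1\<bar> \<le> of_int \<bar>j2' - j1\<bar>"
    using bridge_lipschitz[OF b] by (simp_all only: of_int_le_iff)
  have "snd c = snd c'" using 1 2 L x y by (auto simp: abs_if split: if_splits)
  then show ?thesis using 1(5) 2(5) by (simp add: prod_eq_iff)
qed

text \<open>The two triangles at the flipped edge are distinct, so one uses the rung above and the other the
  rung below, and convexity forces these two rungs to have the same height difference.\<close>

lemma flips_to_ladder:
  assumes b: "bridge (2 * int n) d" and f: "flips_to (ladder n d) e e'"
  shows "\<exists>k\<in>{1..<2 * int n}. corner d k \<and> e = rung k (d k) \<and> e' = rung k (flip_at d k k)"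
proof -
  let ?\<sigma> = "ladder n d"
  obtain p q c c' where e: "e = {p, q}" "e' = {c, c'}" "c \<noteq> c'"
    and t: "triangle_of ?\<sigma> p q c" "triangle_of ?\<sigma> p q c'" and cv: "form_convex_quadrilateral p q c c'"
    using f unfolding flips_to_def by blast
  have pq: "{p, q} \<in> ?\<sigma>" using t(1) by (auto simp: triangle_of_def)
  have main: "\<exists>k\<in>{1..<2 * int n}. corner d k \<and> {p, q} = rung k (d k) \<and> {c, c'} = rung k (flip_at d k k)"
    if t: "triangle_of ?\<sigma> p q c" "triangle_of ?\<sigma> p q c'" and cv: "form_convex_quadrilateral p q c c'"
      and p: "p = (0, of_int (k - d k) / 2)" and q: "q = (1, of_int (k + d k) / 2)" for p q k
  proof -
    have mid: "p \<noteq> midpoint c c'" "q \<noteq> midpoint c c'"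
      using form_convex_quadrilateral_midpoint[OF cv e(3)] by auto
    obtain s where s: "s = 1 \<or> s = - 1" "0 \<le> k + s" "k + s \<le> 2 * int n"
      "d (k + s) = d k - s \<and> c = (0, of_int (k - d k) / 2 + of_int s) \<or>
       d (k + s) = d k + s \<and> c = (1, of_int (k + d k) / 2 + of_int s)"
      by (rule third_vertex[OF b t(1) p q])
    obtain s' where s': "s' = 1 \<or> s' = - 1" "0 \<le> k + s'" "k + s' \<le> 2 * int n"
      "d (k + s') = d k - s' \<and> c' = (0, of_int (k - d k) / 2 + of_int s') \<or>
       d (k + s') = d k + s' \<and> c' = (1, of_int (k + d k) / 2 + of_int s')"
      by (rule third_vertex[OF b t(2) p q])
    have "s \<noteq> s'" using s(4) s'(4) s(1) e(3) by auto
    then have opp: "s' = - s" using s(1) s'(1) by auto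
    have k: "k \<in> {1..<2 * int n}" using s s' opp by auto
    \<comment> \<open>The other two combinations put both third vertices on one side, with an end of the rung midway.\<close>
    consider "d (k + s) = d k - s" "c = (0, of_int (k - d k) / 2 + of_int s)"
        "d (k - s) = d k - s" "c' = (1, of_int (k + d k) / 2 - of_int s)"
      | "d (k + s) = d k + s" "c = (1, of_int (k + d k) / 2 + of_int s)"
        "d (k - s) = d k + s" "c' = (0, of_int (k - d k) / 2 - of_int s)"
      using s(4) s'(4) mid unfolding opp p q by (auto simp: midpoint_def)
    then have "corner d k \<and> {c, c'} = rung k (flip_at d k k)"
    proof cases
      case 1
      then have "d (k + 1) = d k - s" "d (k - 1) = d k - s" using s(1) by auto
      then have "corner d k" "flip_at d k k = d k + 2 * (- s)" by (auto simp: corner_def flip_at_apply)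
      then show ?thesis unfolding 1(2,4) by (simp only: rung_shift) simp
    next
      case 2
      then have "d (k + 1) = d k + s" "d (k - 1) = d k + s" using s(1) by auto
      then have "corner d k" "flip_at d k k = d k + 2 * s" by (auto simp: corner_def flip_at_apply)
      then show ?thesis unfolding 2(2,4) by (simp only: rung_shift) (simp add: insert_commute)
    qed
    then show ?thesis using k p q by (intro bexI[of _ k]) (simp_all add: rung_def)
  qed
  from pq show ?thesis
  proof (cases rule: ladder_edge_cases)
    case 1
    then show ?thesis using rail_not_flippable[OF b t] e(3) by blast
  next
    case (2 k)
    then have "p = (0, of_int (k - d k) / 2)" "q = (1, of_int (k + d k) / 2)" by (simp_all add: prod_eq_iff)
    from main[OF t cv this] show ?thesis unfolding e .
  next
    case (3 k)
    then have "q = (0, of_int (k - d k) / 2)" "p = (1, of_int (k + d k) / 2)" by (simp_all add: prod_eq_iff)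
    moreover have "triangle_of ?\<sigma> q p c" "triangle_of ?\<sigma> q p c'" "form_convex_quadrilateral q p c c'"
      using t cv triangle_of_commute(1) form_convex_quadrilateral_commute(1) by blast+
    moreover have "{p, q} = {q, p}" by (rule insert_commute)
    ultimately show ?thesis using main[of q p k] unfolding e by simp
  qed
qed

lemma ladder_flips_to:
  assumes b: "bridge (2 * int n) d" and k: "k \<in> {1..<2 * int n}" and c: "corner d k"
  shows "flips_to (ladder n d) (rung k (d k)) (rung k (flip_at d k k))"
proof -
  let ?\<sigma> = "ladder n d"
  let ?a = "(0 :: real, of_int (k - d k) / 2 :: real)" and ?b = "(1 :: real, of_int (k + d k) / 2 :: real)"
  have below: "d (k - 1) = d (k + 1)" using c by (simp add: corner_def)
  have "d (k + 1) = d k + 1 \<or> d (k + 1) = d k - 1" using bridge_step[OF b, of k] k by auto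
  then show ?thesis
  proof
    assume up: "d (k + 1) = d k + 1"
    let ?c = "(1 :: real, of_int (k + d k) / 2 + 1 :: real)" and ?d = "(0 :: real, of_int (k - d k) / 2 - 1 :: real)"
    have t1: "triangle_of ?\<sigma> ?a ?b ?c" using triangle_of_ladder(1)[OF b, of k] k up by simp
    have "triangle_of ?\<sigma> ?d ?b ?a"
      using triangle_of_ladder(2)[OF b, of "k - 1"] k up below
      by (simp add: add_divide_distrib diff_divide_distrib)
    then have t2: "triangle_of ?\<sigma> ?a ?b ?d" using triangle_of_commute(2) by blast
    have "\<not> collinear {?a, ?b, ?c}" using t1 by (simp add: triangle_of_def)
    then have "form_convex_quadrilateral ?a ?b ?c ?d" by (rule parallelogram_convex_quadrilateral) simp
    moreover have "flip_at d k k = d k + 2 * 1" using up below by (simp add: flip_at_apply)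
    then have "rung k (flip_at d k k) = {?c, ?d}" by (simp only: rung_shift) (simp add: insert_commute)
    ultimately show ?thesis unfolding flips_to_def using t1 t2
      by (intro exI[of _ ?a] exI[of _ ?b] exI[of _ ?c] exI[of _ ?d]) (simp add: rung_def)
  next
    assume down: "d (k + 1) = d k - 1"
    let ?c = "(0 :: real, of_int (k - d k) / 2 + 1 :: real)" and ?d = "(1 :: real, of_int (k + d k) / 2 - 1 :: real)"
    have t1: "triangle_of ?\<sigma> ?a ?b ?c" using triangle_of_ladder(2)[OF b, of k] k down by simp
    have "triangle_of ?\<sigma> ?a ?d ?b"
      using triangle_of_ladder(1)[OF b, of "k - 1"] k down below
      by (simp add: add_divide_distrib diff_divide_distrib)
    then have t2: "triangle_of ?\<sigma> ?a ?b ?d" using triangle_of_commute by blast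
    have "\<not> collinear {?a, ?b, ?c}" using t1 by (simp add: triangle_of_def)
    then have "form_convex_quadrilateral ?a ?b ?c ?d" by (rule parallelogram_convex_quadrilateral) simp
    moreover have "flip_at d k k = d k + 2 * (- 1)" using down below by (simp add: flip_at_apply)
    then have "rung k (flip_at d k k) = {?c, ?d}" by (simp only: rung_shift) simp
    ultimately show ?thesis unfolding flips_to_def using t1 t2
      by (intro exI[of _ ?a] exI[of _ ?b] exI[of _ ?c] exI[of _ ?d]) (simp add: rung_def)
  qed
qed

section \<open>The Glauber chain on bridges\<close>

lemma midpoints_subset: "midpoints m n \<subseteq> (\<lambda>(i, j). (real i / 2, real j / 2)) ` ({..2 * m} \<times> {..2 * n})"
  unfolding midpoints_def by auto

lemma finite_midpoints: "finite (midpoints m n)"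
  by (rule finite_subset[OF midpoints_subset]) simp

lemma card_midpoints_le: "card (midpoints m n) \<le> (2 * m + 1) * (2 * n + 1)"
proof -
  have "card (midpoints m n) \<le> card ((\<lambda>(i, j). (real i / 2, real j / 2)) ` ({..2 * m} \<times> {..2 * n}))"
    by (rule card_mono[OF _ midpoints_subset]) simp
  also have "\<dots> \<le> card ({..2 * m} \<times> {..2 * n})" by (rule card_image_le) simp
  finally show ?thesis by simp
qed

lemma rung_midpoint_in:
  assumes "0 \<le> k" "k \<le> 2 * int n"
  shows "(1 / 2, of_int k / 2) \<in> midpoints 1 n"
proof -
  have "(1 / 2, of_int k / 2) = (real 1 / 2, real (nat k) / 2)" "(1::nat) \<le> 2 * 1" "nat k \<le> 2 * n"
    using assms by auto
  then have "(1 / 2, of_int k / 2) \<in> {(real i / 2, real j / 2) |i j. i \<le> 2 * 1 \<and> j \<le> 2 * n}" by blast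
  moreover have "1 / 2 \<noteq> real i" for i :: nat
  proof
    assume "1 / 2 = real i"
    then have "real 1 = real (2 * i)" by simp
    then show False unfolding of_nat_eq_iff by presburger
  qed
  then have "(1 / 2, of_int k / 2) \<notin> grid 1 n" by (auto simp: grid_def)
  ultimately show ?thesis by (simp add: midpoints_def)
qed

lemma midpoints_1_cases:
  assumes "x \<in> midpoints 1 n"
  obtains k where "0 \<le> k" "k \<le> 2 * int n" "x = (1 / 2, of_int k / 2)"
  | e where "e \<in> rails n" "edge_midpoint e = x" "fst x \<noteq> 1 / 2"
proof -
  obtain i j where x: "x = (real i / 2, real j / 2)" "i \<le> 2" "j \<le> 2 * n" "x \<notin> grid 1 n"
    using assms by (auto simp: midpoints_def)
  show thesis
  proof (cases "i = 1")
    case True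
    then show thesis using x by (intro that(1)[of "int j"]) auto
  next
    case False
    then obtain i' where i': "i = 2 * i'" "i' = 0 \<or> i' = 1" using x(2)
      by (metis One_nat_def mult_0_right mult_1_right nat_mult_1_right le_SucE le_zero_eq numeral_2_eq_2)
    have "odd j"
    proof
      assume "even j"
      then obtain j' where "j = 2 * j'" by (elim evenE)
      then have "x \<in> grid 1 n" using x i' by (auto simp: grid_def)
      then show False using x(4) by simp
    qed
    then obtain j' where j': "j = 2 * j' + 1" by (elim oddE)
    let ?e = "{(real i', real j'), (real i', real j' + 1)}"
    have "real i' = 0 \<or> real i' = 1" "j' < n" using i' j' x(3) by auto
    then have "?e \<in> rails n" unfolding rails_def by blast
    moreover have "edge_midpoint ?e = x" by (simp add: x(1) i' j' midpoint_def)
    moreover have "fst x \<noteq> 1 / 2" using x(1) i' by auto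
    ultimately show thesis by (rule that(2))
  qed
qed

lemma edge_at_ladder:
  assumes "bridge (2 * int n) d" "e \<in> ladder n d"
  shows "edge_at (ladder n d) (edge_midpoint e) = e"
  by (rule edge_at_eqI[OF ladder_subset_edges[OF assms(1)] noncrossing_ladder[OF assms(1)] assms(2) refl])

lemma edge_at_rung:
  assumes "bridge (2 * int n) d" "0 \<le> k" "k \<le> 2 * int n"
  shows "edge_at (ladder n d) (1 / 2, of_int k / 2) = rung k (d k)"
proof -
  have "rung k (d k) \<in> ladder n d" using assms by (simp add: ladder_def)
  from edge_at_ladder[OF assms(1) this] show ?thesis by (simp add: edge_midpoint_rung)
qed

lemma edge_at_rail:
  assumes "bridge (2 * int n) d" "e \<in> rails n"
  shows "edge_at (ladder n d) (edge_midpoint e) = e"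
  using edge_at_ladder[OF assms(1), of e] assms(2) by (simp add: ladder_def)

lemma ladder_inj:
  assumes "bridge (2 * int n) d" "bridge (2 * int n) d'" "ladder n d = ladder n d'"
  shows "d = d'"
proof
  fix k
  show "d k = d' k"
  proof (cases "0 \<le> k \<and> k \<le> 2 * int n")
    case True
    then have "rung k (d k) = rung k (d' k)"
      using edge_at_rung[OF assms(1), of k] edge_at_rung[OF assms(2), of k] assms(3) by simp
    then show ?thesis by simp
  next
    case False
    then show ?thesis using bridge_outside[OF assms(1), of k] bridge_outside[OF assms(2), of k] by auto
  qed
qed

definition pinned_sites :: "nat \<Rightarrow> point set \<Rightarrow> int set" where
  "pinned_sites n \<Delta> = {k \<in> {0..2 * int n}. (1 / 2, of_int k / 2) \<in> \<Delta>}"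

text \<open>Constraints on rails hold automatically, so the constraints amount to pinning a bridge; the
  heights to pin are read off any triangulation that satisfies them.\<close>

lemma Omega_eq_ladders:
  assumes con: "constraints 1 n \<eta> \<Delta>"
  obtains c where "Omega 1 n \<eta> \<Delta> = ladder n ` pinned_bridges (2 * int n) (pinned_sites n \<Delta>) c"
proof -
  obtain \<sigma> where \<sigma>: "\<sigma> \<in> Omega 1 n \<eta> \<Delta>" using Omega_nonempty[OF con] by blast
  then have "triangulation 1 n \<sigma>" by (simp add: Omega_def)
  then obtain c where c: "bridge (2 * int n) c" "\<sigma> = ladder n c" by (rule triangulation_is_ladder)
  have \<eta>: "edge_at (ladder n c) x = \<eta> x" if "x \<in> \<Delta>" for x using \<sigma> c that by (simp add: Omega_def)
  have sub: "\<Delta> \<subseteq> midpoints 1 n" using con by (simp add: constraints_def)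
  have "Omega 1 n \<eta> \<Delta> = ladder n ` pinned_bridges (2 * int n) (pinned_sites n \<Delta>) c"
  proof (intro equalityI subsetI)
    fix \<tau> assume \<tau>: "\<tau> \<in> Omega 1 n \<eta> \<Delta>"
    then have "triangulation 1 n \<tau>" by (simp add: Omega_def)
    then obtain d where d: "bridge (2 * int n) d" "\<tau> = ladder n d" by (rule triangulation_is_ladder)
    have "d k = c k" if k: "k \<in> pinned_sites n \<Delta>" for k
    proof -
      have "edge_at (ladder n d) (1 / 2, of_int k / 2) = edge_at (ladder n c) (1 / 2, of_int k / 2)"
        using \<tau> d(2) \<eta> k by (simp add: Omega_def pinned_sites_def)
      then show ?thesis using edge_at_rung[OF d(1), of k] edge_at_rung[OF c(1), of k] k
        by (simp add: pinned_sites_def)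
    qed
    then show "\<tau> \<in> ladder n ` pinned_bridges (2 * int n) (pinned_sites n \<Delta>) c"
      using d by (auto simp: pinned_bridges_def)
  next
    fix \<tau> assume "\<tau> \<in> ladder n ` pinned_bridges (2 * int n) (pinned_sites n \<Delta>) c"
    then obtain d where d: "bridge (2 * int n) d" "\<tau> = ladder n d" "\<forall>k\<in>pinned_sites n \<Delta>. d k = c k"
      by (auto simp: pinned_bridges_def)
    have "edge_at \<tau> x = \<eta> x" if x: "x \<in> \<Delta>" for x
    proof -
      have "x \<in> midpoints 1 n" using x sub by blast
      then have "edge_at (ladder n d) x = edge_at (ladder n c) x"
      proof (cases rule: midpoints_1_cases)
        case (1 k)
        then have "d k = c k" using d(3) x by (simp add: pinned_sites_def)
        then show ?thesis using 1 edge_at_rung[OF d(1), of k] edge_at_rung[OF c(1), of k] by simp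
      next
        case (2 e)
        then show ?thesis using edge_at_rail[OF d(1), of e] edge_at_rail[OF c(1), of e] by simp
      qed
      then show ?thesis using \<eta>[OF x] d(2) by simp
    qed
    then show "\<tau> \<in> Omega 1 n \<eta> \<Delta>" using triangulation_ladder[OF d(1)] d(2) by (simp add: Omega_def)
  qed
  then show thesis by (rule that)
qed

lemma powr_abs_of_int:
  fixes lam :: real
  assumes "0 < lam"
  shows "lam powr \<bar>of_int h\<bar> = lam ^ nat \<bar>h\<bar>"
proof -
  have "\<bar>real_of_int h\<bar> = real (nat \<bar>h\<bar>)" by simp
  then show ?thesis using assms by (simp only: powr_realpow)
qed

lemma flippable_ladder:
  assumes b: "bridge (2 * int n) d" and x: "x \<in> midpoints 1 n"
  shows "flippable (ladder n d) x \<longleftrightarrow> (\<exists>k\<in>{1..<2 * int n}. corner d k \<and> x = (1 / 2, of_int k / 2))"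
proof
  assume "flippable (ladder n d) x"
  then obtain e' where "flips_to (ladder n d) (edge_at (ladder n d) x) e'" by (auto simp: flippable_def)
  then obtain k where k: "k \<in> {1..<2 * int n}" "corner d k" "edge_at (ladder n d) x = rung k (d k)"
    using flips_to_ladder[OF b] by blast
  show "\<exists>k\<in>{1..<2 * int n}. corner d k \<and> x = (1 / 2, of_int k / 2)"
    using x
  proof (cases rule: midpoints_1_cases)
    case (1 j)
    then have "j = k" using k(3) edge_at_rung[OF b, of j] by simp
    then show ?thesis using 1 k by auto
  next
    case (2 e)
    then have "rung k (d k) \<in> rails n" using k(3) edge_at_rail[OF b, of e] by simp
    then show ?thesis by (simp add: rung_notin_rails)
  qed
next
  assume "\<exists>k\<in>{1..<2 * int n}. corner d k \<and> x = (1 / 2, of_int k / 2)"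
  then obtain k where k: "k \<in> {1..<2 * int n}" "corner d k" "x = (1 / 2, of_int k / 2)" by blast
  then show "flippable (ladder n d) x"
    using ladder_flips_to[OF b k(1,2)] edge_at_rung[OF b, of k] by (auto simp: flippable_def)
qed

lemma flip_ladder:
  assumes b: "bridge (2 * int n) d" and k: "k \<in> {1..<2 * int n}" "corner d k"
  shows "flipped_edge (ladder n d) (1 / 2, of_int k / 2) = rung k (flip_at d k k)"
    and "flip (ladder n d) (1 / 2, of_int k / 2) = ladder n (flip_at d k)"
    and "0 < lam \<Longrightarrow> flip_prob lam (ladder n d) (1 / 2, of_int k / 2) = flip_weight lam d k"
proof -
  have at: "edge_at (ladder n d) (1 / 2, of_int k / 2) = rung k (d k)"
    using edge_at_rung[OF b, of k] k(1) by simp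
  show fe: "flipped_edge (ladder n d) (1 / 2, of_int k / 2) = rung k (flip_at d k k)"
    unfolding flipped_edge_def at
  proof (rule the_equality)
    fix e' assume "flips_to (ladder n d) (rung k (d k)) e'"
    from flips_to_ladder[OF b this] show "e' = rung k (flip_at d k k)" by auto
  qed (rule ladder_flips_to[OF b k])
  let ?I = "{0..2 * int n}" and ?A = "(\<lambda>j. rung j (flip_at d k j)) ` ({0..2 * int n} - {k})"
  have "(\<lambda>j. rung j (d j)) ` ?I - {rung k (d k)} = (\<lambda>j. rung j (d j)) ` (?I - {k})" by auto
  also have "\<dots> = ?A" by (intro image_cong) (auto simp: flip_at_apply)
  finally have minus: "ladder n d - {rung k (d k)} = rails n \<union> ?A"
    using rung_notin_rails[of k "d k" n] unfolding ladder_def Un_Diff by simp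
  have "?I = insert k (?I - {k})" using k(1) by auto
  then have "(\<lambda>j. rung j (flip_at d k j)) ` ?I = insert (rung k (flip_at d k k)) ?A"
    by (metis image_insert)
  then show "flip (ladder n d) (1 / 2, of_int k / 2) = ladder n (flip_at d k)"
    unfolding flip_def fe at minus by (simp add: ladder_def)
  show "flip_prob lam (ladder n d) (1 / 2, of_int k / 2) = flip_weight lam d k" if "0 < lam"
    using that by (simp add: flip_prob_def fe at edge_length_rung powr_add powr_abs_of_int
        flip_weight_def flip: distrib_left)
qed

lemma finite_set_glauber_step: "finite (set_pmf (glauber_step lam m n \<Delta> \<sigma>))"
proof -
  have "finite (midpoints m n - \<Delta>)" by (simp add: finite_midpoints)
  then show ?thesis by (auto simp: glauber_step_def)
qed

text \<open>Splitting off the first step instead of the last one turns the probability of an event into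
  iterates of the Markov operator on functions of the initial state.\<close>

lemma glauber_law_Suc:
  "glauber_law lam m n \<Delta> (Suc t) \<sigma> = bind_pmf (glauber_step lam m n \<Delta> \<sigma>) (glauber_law lam m n \<Delta> t)"
proof (induction t arbitrary: \<sigma>)
  case (Suc t)
  have "glauber_law lam m n \<Delta> (Suc (Suc t)) \<sigma>
      = bind_pmf (glauber_law lam m n \<Delta> (Suc t) \<sigma>) (glauber_step lam m n \<Delta>)" by simp
  also have "\<dots> = bind_pmf (glauber_step lam m n \<Delta> \<sigma>)
      (\<lambda>\<tau>. bind_pmf (glauber_law lam m n \<Delta> t \<tau>) (glauber_step lam m n \<Delta>))"
    unfolding Suc by (rule bind_assoc_pmf)
  also have "(\<lambda>\<tau>. bind_pmf (glauber_law lam m n \<Delta> t \<tau>) (glauber_step lam m n \<Delta>))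
      = glauber_law lam m n \<Delta> (Suc t)"
    by (rule ext) simp
  finally show ?case .
next
  case 0
  have "glauber_law lam m n \<Delta> 0 = return_pmf" by (rule ext) simp
  then show ?case by (simp add: bind_return_pmf bind_return_pmf')
qed

lemma finite_set_glauber_law: "finite (set_pmf (glauber_law lam m n \<Delta> t \<sigma>))"
  by (induction t) (auto simp: finite_set_glauber_step)

lemma prob_glauber_law_Suc:
  "measure_pmf.prob (glauber_law lam m n \<Delta> (Suc t) \<sigma>) A
     = measure_pmf.expectation (glauber_step lam m n \<Delta> \<sigma>) (\<lambda>\<tau>. measure_pmf.prob (glauber_law lam m n \<Delta> t \<tau>) A)"
proof -
  let ?p = "glauber_step lam m n \<Delta> \<sigma>" and ?f = "glauber_law lam m n \<Delta> t"
  have "measure_pmf.expectation (bind_pmf ?p ?f) (indicator A :: _ \<Rightarrow> real)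
      = (\<Sum>\<tau>\<in>set_pmf ?p. pmf ?p \<tau> *\<^sub>R measure_pmf.expectation (?f \<tau>) (indicator A))"
    by (rule pmf_expectation_bind) (auto simp: finite_set_glauber_step finite_set_glauber_law)
  also have "\<dots> = measure_pmf.expectation ?p (\<lambda>\<tau>. measure_pmf.expectation (?f \<tau>) (indicator A))"
    by (rule integral_measure_pmf[symmetric]) (auto simp: finite_set_glauber_step)
  finally show ?thesis unfolding glauber_law_Suc by simp
qed

text \<open>The maximum with one covers the case that all midpoints are constrained: then no site is
  free, and neither side moves.\<close>

lemma expectation_glauber_step:
  assumes lam: "0 < lam" "lam < 1" and b: "bridge (2 * int n) d"
  shows "measure_pmf.expectation (glauber_step lam 1 n \<Delta> (ladder n d)) h
    = one_step lam (max 1 (card (midpoints 1 n - \<Delta>))) ({1..<2 * int n} - pinned_sites n \<Delta>) (\<lambda>d. h (ladder n d)) d"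
proof -
  let ?X = "midpoints 1 n - \<Delta>" and ?F = "{1..<2 * int n} - pinned_sites n \<Delta>"
  let ?\<sigma> = "ladder n d" and ?m = "\<lambda>k::int. (1 / 2 :: real, of_int k / 2 :: real)"
  have img: "?m ` ?F \<subseteq> ?X" using rung_midpoint_in by (auto simp: pinned_sites_def)
  have inj: "inj_on ?m ?F" by (auto simp: inj_on_def)
  show ?thesis
  proof (cases "?X = {}")
    case True
    then have F: "?F = {}" using img by blast
    show ?thesis unfolding F one_step_def glauber_step_def using True by simp
  next
    case False
    define q where "q x = (if flippable ?\<sigma> x
      then map_pmf (\<lambda>b. if b then flip ?\<sigma> x else ?\<sigma>) (bernoulli_pmf (flip_prob lam ?\<sigma> x))
      else return_pmf ?\<sigma>)" for x
    have fX: "finite ?X" by (simp add: finite_midpoints)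
    have c: "0 < card ?X" using fX False by (simp add: card_gt_0_iff)
    have off: "measure_pmf.expectation (q x) h = h ?\<sigma>" if x: "x \<in> ?X - ?m ` ?F" for x
    proof -
      have "\<not> flippable ?\<sigma> x"
      proof
        assume "flippable ?\<sigma> x"
        then obtain k where "k \<in> {1..<2 * int n}" "x = ?m k" using flippable_ladder[OF b, of x] x by auto
        then show False using x by (auto simp: pinned_sites_def)
      qed
      then show ?thesis by (simp add: q_def)
    qed
    have on: "measure_pmf.expectation (q (?m k)) h - h ?\<sigma> = jump lam (\<lambda>d. h (ladder n d)) d k"
      if k: "k \<in> ?F" for k
    proof -
      have x: "?m k \<in> midpoints 1 n" using img k by blast
      show ?thesis
      proof (cases "corner d k")
        case True
        have kN: "k \<in> {1..<2 * int n}" using k by blast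
        have "flippable ?\<sigma> (?m k)" using flippable_ladder[OF b x] True kN by blast
        moreover have "0 \<le> flip_weight lam d k" "flip_weight lam d k \<le> 1"
          using flip_weight_bounds[OF lam] by auto
        ultimately show ?thesis
          using flip_ladder(2)[OF b kN True] flip_ladder(3)[OF b kN True lam(1)] True
          by (simp add: q_def jump_def algebra_simps)
      next
        case False
        then have "\<not> flippable ?\<sigma> (?m k)" using flippable_ladder[OF b x] by auto
        then show ?thesis using False by (simp add: q_def jump_def)
      qed
    qed
    have "finite (set_pmf (q x))" for x by (simp add: q_def)
    then have "measure_pmf.expectation (glauber_step lam 1 n \<Delta> ?\<sigma>) h
        = (\<Sum>x\<in>?X. measure_pmf.expectation (q x) h /\<^sub>R card ?X)"
      using False fX unfolding glauber_step_def q_def[symmetric]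
      by (simp add: pmf_expectation_bind_pmf_of_set)
    also have "\<dots> = (\<Sum>x\<in>?X. h ?\<sigma> + (measure_pmf.expectation (q x) h - h ?\<sigma>)) / card ?X"
      by (simp add: sum_distrib_left divide_inverse mult.commute)
    also have "\<dots> = h ?\<sigma> + (\<Sum>x\<in>?X. measure_pmf.expectation (q x) h - h ?\<sigma>) / card ?X"
      unfolding sum.distrib using c by (simp add: field_simps)
    also have "(\<Sum>x\<in>?X. measure_pmf.expectation (q x) h - h ?\<sigma>)
        = (\<Sum>x\<in>?m ` ?F. measure_pmf.expectation (q x) h - h ?\<sigma>)"
      using fX img off by (intro sum.mono_neutral_right) auto
    also have "\<dots> = (\<Sum>k\<in>?F. jump lam (\<lambda>d. h (ladder n d)) d k)"
      using on by (subst sum.reindex[OF inj]) (auto intro!: sum.cong)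
    finally show ?thesis using c by (simp add: one_step_def)
  qed
qed


text \<open>The constant collects the rails and the horizontal extent of the rungs; it cancels in the Gibbs
  distribution.\<close>

lemma total_length_ladder:
  assumes "bridge (2 * int n) c"
  obtains l where "\<And>d. bridge (2 * int n) d \<Longrightarrow>
    total_length 1 n (ladder n d) = l + (\<Sum>k\<in>{0..2 * int n}. real (nat \<bar>d k\<bar>))"
proof -
  let ?m = "\<lambda>k::int. (1 / 2 :: real, of_int k / 2 :: real)" and ?K = "{0..2 * int n}"
  define l where "l = (\<Sum>x\<in>midpoints 1 n - ?m ` ?K. edge_length (edge_at (ladder n c) x)) + card ?K"
  have inj: "inj_on ?m ?K" by (auto simp: inj_on_def)
  have img: "?m ` ?K \<subseteq> midpoints 1 n" using rung_midpoint_in by auto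
  have "total_length 1 n (ladder n d) = l + (\<Sum>k\<in>?K. real (nat \<bar>d k\<bar>))" if d: "bridge (2 * int n) d" for d
  proof -
    have "(\<Sum>x\<in>midpoints 1 n - ?m ` ?K. edge_length (edge_at (ladder n d) x))
        = (\<Sum>x\<in>midpoints 1 n - ?m ` ?K. edge_length (edge_at (ladder n c) x))"
    proof (rule sum.cong[OF refl])
      fix x assume x: "x \<in> midpoints 1 n - ?m ` ?K"
      then have "x \<in> midpoints 1 n" by blast
      then show "edge_length (edge_at (ladder n d) x) = edge_length (edge_at (ladder n c) x)"
      proof (cases rule: midpoints_1_cases)
        case (1 k) then show ?thesis using x by auto
      next
        case (2 e) then show ?thesis using edge_at_rail[OF d, of e] edge_at_rail[OF assms, of e] by simp
      qed
    qed
    moreover have "(\<Sum>x\<in>?m ` ?K. edge_length (edge_at (ladder n d) x)) = (\<Sum>k\<in>?K. 1 + real (nat \<bar>d k\<bar>))"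
      using edge_at_rung[OF d]
      by (subst sum.reindex[OF inj]) (auto intro!: sum.cong simp: edge_length_rung)
    ultimately show ?thesis
      using sum.subset_diff[OF img finite_midpoints, of "\<lambda>x. edge_length (edge_at (ladder n d) x)"]
      by (simp add: total_length_def l_def sum.distrib)
  qed
  then show thesis by (rule that)
qed

lemma prob_gibbs:
  assumes lam: "0 < lam" and con: "constraints 1 n \<eta> \<Delta>"
    and \<Omega>: "Omega 1 n \<eta> \<Delta> = ladder n ` pinned_bridges (2 * int n) K c"
  shows "measure_pmf.prob (gibbs lam 1 n \<eta> \<Delta>) A =
    (\<Sum>d\<in>pinned_bridges (2 * int n) K c. bridge_weight lam (2 * int n) d * indicator A (ladder n d))
      / (\<Sum>d\<in>pinned_bridges (2 * int n) K c. bridge_weight lam (2 * int n) d)"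
proof -
  let ?N = "2 * int n" and ?P = "pinned_bridges (2 * int n) K c" and ?W = "bridge_weight lam (2 * int n)"
  have inj: "inj_on (ladder n) ?P" by (auto simp: inj_on_def pinned_bridges_def intro: ladder_inj)
  obtain d0 where "d0 \<in> ?P" using Omega_nonempty[OF con] \<Omega> by blast
  then have "bridge ?N d0" by (simp add: pinned_bridges_def)
  then obtain l where l: "\<And>d. bridge ?N d \<Longrightarrow>
      total_length 1 n (ladder n d) = l + (\<Sum>k\<in>{0..?N}. real (nat \<bar>d k\<bar>))"
    by (rule total_length_ladder) blast
  have w: "lam powr total_length 1 n (ladder n d) = lam powr l * ?W d" if "d \<in> ?P" for d
  proof -
    have "lam powr (\<Sum>k\<in>{0..?N}. real (nat \<bar>d k\<bar>)) = ?W d"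
      using lam by (simp add: powr_sum powr_abs_of_int bridge_weight_def)
    then show ?thesis using l[of d] that by (simp add: pinned_bridges_def powr_add)
  qed
  have Z: "partition_function lam 1 n \<eta> \<Delta> = lam powr l * (\<Sum>d\<in>?P. ?W d)"
    unfolding partition_function_def \<Omega> sum.reindex[OF inj]
    using w by (simp add: sum_distrib_left)
  have p: "pmf (gibbs lam 1 n \<eta> \<Delta>) (ladder n d) = ?W d / (\<Sum>d\<in>?P. ?W d)" if d: "d \<in> ?P" for d
  proof -
    have "ladder n d \<in> Omega 1 n \<eta> \<Delta>" using d \<Omega> by blast
    then show ?thesis unfolding pmf_gibbs[OF lam con] Z using w[OF d] lam by simp
  qed
  have "measure_pmf.prob (gibbs lam 1 n \<eta> \<Delta>) A
      = measure_pmf.expectation (gibbs lam 1 n \<eta> \<Delta>) (indicator A :: _ \<Rightarrow> real)" by simp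
  also have "\<dots> = (\<Sum>\<sigma>\<in>Omega 1 n \<eta> \<Delta>. pmf (gibbs lam 1 n \<eta> \<Delta>) \<sigma> *\<^sub>R indicator A \<sigma>)"
    by (rule integral_measure_pmf[OF finite_Omega])
      (metis set_pmf_iff pmf_gibbs[OF lam con])
  also have "\<dots> = (\<Sum>d\<in>?P. ?W d / (\<Sum>d\<in>?P. ?W d) * indicator A (ladder n d))"
    unfolding \<Omega> sum.reindex[OF inj] using p by (intro sum.cong) auto
  finally show ?thesis by (simp add: sum_divide_distrib)
qed

section \<open>Mixing time\<close>

lemma tv_dist_glauber_gibbs_le:
  assumes lam: "0 < lam" "lam < 1" and con: "constraints 1 n \<eta> \<Delta>" and \<sigma>: "\<sigma> \<in> Omega 1 n \<eta> \<Delta>"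
  shows "tv_dist (glauber_law lam 1 n \<Delta> t \<sigma>) (gibbs lam 1 n \<eta> \<Delta>)
    \<le> (1 - gap lam / max 1 (card (midpoints 1 n - \<Delta>))) ^ t * ((1 / lam) ^ (2 * n) * ((2 * n + 1) * (4 * n)))"
proof -
  let ?N = "2 * int n" and ?K = "pinned_sites n \<Delta>" and ?M = "max 1 (card (midpoints 1 n - \<Delta>))"
  obtain c where \<Omega>: "Omega 1 n \<eta> \<Delta> = ladder n ` pinned_bridges ?N ?K c"
    using Omega_eq_ladders[OF con] by blast
  obtain d where d: "d \<in> pinned_bridges ?N ?K c" "\<sigma> = ladder n d" using \<sigma> \<Omega> by blast
  have "card ({1..<?N} - ?K) = card ((\<lambda>k::int. (1 / 2 :: real, of_int k / 2 :: real)) ` ({1..<?N} - ?K))"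
    by (intro card_image[symmetric]) (auto simp: inj_on_def)
  also have "\<dots> \<le> card (midpoints 1 n - \<Delta>)"
    using rung_midpoint_in by (intro card_mono) (auto simp: finite_midpoints pinned_sites_def)
  finally have M: "card ({1..<?N} - ?K) \<le> ?M" by simp
  have "\<bar>measure_pmf.prob (glauber_law lam 1 n \<Delta> t \<sigma>) A - measure_pmf.prob (gibbs lam 1 n \<eta> \<Delta>) A\<bar>
      \<le> (1 - gap lam / ?M) ^ t * ((1 / lam) ^ (2 * n) * ((2 * n + 1) * (4 * n)))" for A
  proof -
    define g where "g t d = measure_pmf.prob (glauber_law lam 1 n \<Delta> t (ladder n d)) A" for t d
    have "g (Suc t) e = one_step lam ?M ({1..<?N} - ?K) (g t) e" if "e \<in> pinned_bridges ?N ?K c" for t e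
      using that unfolding g_def prob_glauber_law_Suc
      by (subst expectation_glauber_step[OF lam]) (simp_all add: pinned_bridges_def)
    from iterated_one_step_near_mean[where g = g and t = t, OF lam _ M _ _ _ this d(1)]
    have "\<bar>g t d - (\<Sum>e\<in>pinned_bridges ?N ?K c. bridge_weight lam ?N e * g 0 e)
            / (\<Sum>e\<in>pinned_bridges ?N ?K c. bridge_weight lam ?N e)\<bar>
        \<le> (1 - gap lam / ?M) ^ t * ((1 / lam) ^ nat ?N * of_int ((?N + 1) * (2 * ?N)))"
      by (simp add: g_def)
    moreover have "nat ?N = 2 * n" "real_of_int ((?N + 1) * (2 * ?N)) = real ((2 * n + 1) * (4 * n))"
      by (auto simp: algebra_simps)
    moreover have "g 0 e = indicator A (ladder n e)" for e by (simp add: g_def)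
    ultimately show ?thesis unfolding prob_gibbs[OF lam(1) con \<Omega>] d(2) g_def by simp
  qed
  then show ?thesis unfolding tv_dist_def by (intro cSUP_least) auto
qed

lemma square_le_exp: "(real n)\<^sup>2 \<le> exp (2 * real n)"
proof -
  have "real n \<le> exp (real n)" using exp_ge_add_one_self[of "real n"] by linarith
  then have "(real n)\<^sup>2 \<le> (exp (real n))\<^sup>2" by (intro power_mono) auto
  then show ?thesis by (simp add: exp_double)
qed

text \<open>With \<open>M \<le> 9 n\<close> the factor \<open>exp (- gap \<cdot> t / M)\<close> has to beat a diameter of size
  \<open>exp (2 n ln (1 / \<lambda>))\<close> times a polynomial, which is absorbed in \<open>exp (8 n)\<close>.\<close>

lemma decay_quarter:
  fixes lam :: real and n M t :: nat
  assumes lam: "0 < lam" "lam < 1" and n: "1 \<le> n" and M: "0 < M" "M \<le> 9 * n"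
    and t: "9 * (8 + 2 * ln (1 / lam)) / gap lam * (real n)\<^sup>2 \<le> t"
  shows "(1 - gap lam / M) ^ t * ((1 / lam) ^ (2 * n) * ((2 * n + 1) * (4 * n))) \<le> 1 / 4"
proof -
  have g: "0 < gap lam" "gap lam \<le> 1" using gap_bounds[OF lam] by auto
  define a where "a = (8 + 2 * ln (1 / lam)) * n"
  have "a = gap lam / (9 * n) * (9 * (8 + 2 * ln (1 / lam)) / gap lam * (real n)\<^sup>2)"
    using g n by (simp add: a_def field_simps power2_eq_square)
  also have "\<dots> \<le> gap lam / (9 * n) * t" using t g by (intro mult_left_mono) auto
  also have "\<dots> \<le> gap lam / M * t"
    using g M by (intro mult_right_mono divide_left_mono) auto
  finally have a: "a \<le> gap lam / M * t" .
  have "1 - gap lam / M \<le> exp (- (gap lam / M))" using exp_ge_add_one_self[of "- (gap lam / M)"] by simp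
  moreover have "gap lam / M \<le> 1" using g M by (simp add: divide_simps)
  ultimately have "(1 - gap lam / M) ^ t \<le> exp (- (gap lam / M)) ^ t" by (intro power_mono) auto
  also have "\<dots> = exp (- (gap lam / M * t))" by (simp add: exp_of_nat_mult[symmetric] mult.commute)
  also have "\<dots> \<le> exp (- a)" using a by simp
  finally have decay: "(1 - gap lam / M) ^ t \<le> exp (- a)" .
  have "(1 / lam) ^ (2 * n) = exp (ln (1 / lam)) ^ (2 * n)" using lam by simp
  also have "\<dots> = exp (2 * ln (1 / lam) * n)" by (simp only: exp_of_nat_mult[symmetric]) (simp add: mult_ac)
  finally have L: "(1 / lam) ^ (2 * n) = exp (2 * ln (1 / lam) * n)" .
  have "n * 1 \<le> n * n" using n by (intro mult_left_mono) auto
  then have "4 * ((2 * n + 1) * (4 * n)) \<le> 48 * n ^ 2" by (simp add: power2_eq_square algebra_simps)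
  then have "real (4 * ((2 * n + 1) * (4 * n))) \<le> real (48 * n ^ 2)" by (simp only: of_nat_le_iff)
  also have "\<dots> = 48 * (real n)\<^sup>2" by simp
  also have "\<dots> \<le> exp (6 * real n) * exp (2 * real n)"
  proof (intro mult_mono square_le_exp)
    have "(2::real) ^ 6 \<le> exp 1 ^ 6" using exp_ge_add_one_self[of 1] by (intro power_mono) auto
    also have "\<dots> = exp 6" by (simp add: exp_of_nat_mult[symmetric])
    also have "\<dots> \<le> exp (6 * real n)" using n by simp
    finally show "48 \<le> exp (6 * real n)" by simp
  qed auto
  finally have poly: "4 * real ((2 * n + 1) * (4 * n)) \<le> exp (8 * real n)" by (simp add: exp_add[symmetric])
  have "4 * ((1 - gap lam / M) ^ t * ((1 / lam) ^ (2 * n) * ((2 * n + 1) * (4 * n))))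
      = (1 - gap lam / M) ^ t * (exp (2 * ln (1 / lam) * n) * (4 * real ((2 * n + 1) * (4 * n))))"
    unfolding L by simp
  also have "\<dots> \<le> exp (- a) * (exp (2 * ln (1 / lam) * n) * exp (8 * real n))"
    using decay poly by (intro mult_mono) auto
  also have "\<dots> = 1" by (simp add: exp_add[symmetric] a_def algebra_simps)
  finally show ?thesis by simp
qed

theorem theorem5p3:
  fixes lam :: real
  assumes "0 < lam" and "lam < 1"
  shows "\<exists>C>0. \<forall>n\<ge>1. \<forall>\<eta> \<Delta>. constraints 1 n \<eta> \<Delta> \<longrightarrow>
           ereal_of_enat (mixing_time lam 1 n \<eta> \<Delta>) \<le> ereal (C * (real n)\<^sup>2)"
proof -
  define B where "B = 9 * (8 + 2 * ln (1 / lam)) / gap lam"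
  have "0 < ln (1 / lam)" using assms by (simp add: ln_div)
  then have B: "0 < B" using gap_bounds[OF assms] by (simp add: B_def)
  have "ereal_of_enat (mixing_time lam 1 n \<eta> \<Delta>) \<le> ereal ((B + 1) * (real n)\<^sup>2)"
    if n: "1 \<le> n" and con: "constraints 1 n \<eta> \<Delta>" for n \<eta> \<Delta>
  proof -
    let ?M = "max 1 (card (midpoints 1 n - \<Delta>))"
    define t where "t = nat \<lceil>B * (real n)\<^sup>2\<rceil>"
    have t: "B * (real n)\<^sup>2 \<le> t" unfolding t_def by linarith
    have "0 \<le> B * (real n)\<^sup>2" using B by simp
    then have "real t \<le> B * (real n)\<^sup>2 + 1" unfolding t_def by linarith
    also have "\<dots> \<le> (B + 1) * (real n)\<^sup>2" using n by (simp add: algebra_simps)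
    finally have t': "real t \<le> (B + 1) * (real n)\<^sup>2" .
    have "card (midpoints 1 n - \<Delta>) \<le> card (midpoints 1 n)"
      by (intro card_mono) (auto simp: finite_midpoints)
    then have M: "?M \<le> 9 * n" using card_midpoints_le[of 1 n] n by simp
    have "tv_dist (glauber_law lam 1 n \<Delta> t \<sigma>) (gibbs lam 1 n \<eta> \<Delta>) \<le> 1 / 4"
      if \<sigma>: "\<sigma> \<in> Omega 1 n \<eta> \<Delta>" for \<sigma>
      by (rule order.trans[OF tv_dist_glauber_gibbs_le[OF assms con \<sigma>]])
        (rule decay_quarter[OF assms n _ M t[unfolded B_def]], simp)
    then have "Max ((\<lambda>\<sigma>. tv_dist (glauber_law lam 1 n \<Delta> t \<sigma>) (gibbs lam 1 n \<eta> \<Delta>)) ` Omega 1 n \<eta> \<Delta>) \<le> 1 / 4"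
      using finite_Omega Omega_nonempty[OF con] by (subst Max_le_iff) auto
    then have "mixing_time lam 1 n \<eta> \<Delta> \<le> enat t"
      unfolding mixing_time_def by (intro Inf_lower) auto
    then have "ereal_of_enat (mixing_time lam 1 n \<eta> \<Delta>) \<le> ereal_of_enat (enat t)"
      by (simp only: ereal_of_enat_le_iff)
    also have "\<dots> \<le> ereal ((B + 1) * (real n)\<^sup>2)" using t' by simp
    finally show ?thesis .
  qed
  then show ?thesis using B by (intro exI[of _ "B + 1"]) auto
qed

end
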